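(* Let $K$ be a virtual knot with crossing number $n$. Then $g_s(K)\le n/2$. If moreover $K$ contains both positive and negative crossings (that is, $K$ is represented by a Gauss diagram with exactly $n$ chords, containing both positive and negative chords), then $g_s(K)\le (n-1)/2$.
   Context: A virtual link diagram is a regular immersion of a disjoint union of (oriented) circles in the plane whose double points are each marked as either a classical crossing (with over/under information) or a virtual crossing. Two diagrams are equivalent if they are related by planar isotopies and generalized Reidemeister moves: the three classical Reidemeister moves, their three analogues in which all crossings are virtual, and the mixed move in which an arc having two consecutive virtual crossings is moved across a classical crossing. A virtual link is an equivalence class of diagrams; a virtual knot is a virtual link with one component. The crossing number of a virtual knot is the minimum number of classical crossings over all diagrams representing it. A classical crossing is positive (negative) if it is right-handed (left-handed). A Gauss diagram of a virtual knot diagram is a counterclockwise-oriented circle together with one directed signed chord for each classical crossing, connecting the two preimages of the crossing, directed from the over-crossing point to the under-crossing point, and labelled by the sign $\pm$ of the crossing. Virtual knots are equivalently equivalence classes of Gauss diagrams under the moves induced by Reidemeister moves. A cobordism between virtual knots $K_0$ and $K_1$ is a finite sequence of births (adding a disjoint unknotted circle), deaths (removing a disjoint unknotted circle) and oriented saddle moves (interspersed with generalized Reidemeister moves) transforming $K_0$ into $K_1$, such that the associated surface co-bounding $K_0\sqcup -K_1$ is connected. If it has $s$ saddles, $b$ births and $d$ deaths, its genus is $(s-b-d)/2$. The slice genus $g_s(K)$ is the minimum genus over all cobordisms from $K$ to the unknot. *)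

theory Defs
  imports Complex_Main
begin

section \<open>Gauss diagrams\<close>

text \<open>
  A Gauss diagram on a disjoint union of oriented circles is written as the list of its circles,
  each circle being the list of chord endpoints met when traversing it once along its orientation,
  from an arbitrary base point. A circle without chords is the empty list. The chord with label
  \<open>a\<close> and sign \<open>s\<close> is directed from its endpoint \<open>Over a s\<close> to its endpoint \<open>Under a s\<close>. Virtual
  crossings leave no trace in a Gauss diagram.
\<close>

datatype endpoint = Over (label: nat) (csign: int) | Under (label: nat) (csign: int)

fun map_label :: "(nat \<Rightarrow> nat) \<Rightarrow> endpoint \<Rightarrow> endpoint" where
  "map_label f (Over a s) = Over (f a) s"
| "map_label f (Under a s) = Under (f a) s"

type_synonym diagram = "endpoint list list"

definition gauss_diagram :: "diagram \<Rightarrow> bool" where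
  "gauss_diagram D \<longleftrightarrow>
     distinct (concat D) \<and>
     (\<forall>a s. Over a s \<in> set (concat D) \<longleftrightarrow> Under a s \<in> set (concat D)) \<and>
     (\<forall>a s t. Over a s \<in> set (concat D) \<longrightarrow> Over a t \<in> set (concat D) \<longrightarrow> s = t) \<and>
     (\<forall>e \<in> set (concat D). csign e \<in> {1, -1})"

definition chords :: "diagram \<Rightarrow> (nat \<times> int) set" where
  "chords D = {(a, s). Over a s \<in> set (concat D)}"

definition knot_diagram :: "diagram \<Rightarrow> bool" where
  "knot_diagram D \<longleftrightarrow> gauss_diagram D \<and> length D = 1"


section \<open>Reidemeister moves\<close>

text \<open>\<open>strand e x y\<close> meets \<open>x\<close> before \<open>y\<close> if \<open>e = 1\<close>, and \<open>y\<close> before \<open>x\<close> if \<open>e = -1\<close>.\<close>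

definition strand :: "int \<Rightarrow> endpoint \<Rightarrow> endpoint \<Rightarrow> endpoint list" where
  "strand e x y = (if e = 1 then [x, y] else [y, x])"

text \<open>
  \<open>local_move B B'\<close>: the arcs involved in a classical Reidemeister move carry the endpoint
  sequences \<open>B ! 0, B ! 1, \<dots>\<close> before and \<open>B' ! 0, B' ! 1, \<dots>\<close> after the move.

  In \<open>R3\<close> the arcs are the top, middle and bottom strand, with crossings \<open>x\<close> (top/middle), \<open>y\<close>
  (top/bottom) and \<open>z\<close> (middle/bottom). The constraint says that they bound a planar triangle:
  let the strands be straight lines with directions \<open>t\<close>, \<open>m\<close>, \<open>b\<close> and meeting points \<open>X\<close>, \<open>Y\<close>, \<open>Z\<close>.
  The sign of a crossing is the sign of \<open>det (over direction, under direction)\<close>, and the signs of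
  the real coefficients in \<open>Y - X = \<alpha> t\<close>, \<open>Z - X = \<beta> m\<close>, \<open>Z - Y = \<gamma> b\<close> record the order of the
  crossings along the strands. Taking determinants of \<open>\<alpha> t + \<gamma> b = \<beta> m\<close> with \<open>m\<close> and with \<open>t\<close>
  gives the two equations; conversely every solution arises from three such lines.
\<close>

inductive local_move :: "endpoint list list \<Rightarrow> endpoint list list \<Rightarrow> bool" where
  R1_over: "local_move [[]] [[Over a s, Under a s]]"
| R1_under: "local_move [[]] [[Under a s, Over a s]]"
| R2_parallel:
    "local_move [[], []] [[Over a s, Over b (- s)], [Under a s, Under b (- s)]]"
| R2_antiparallel:
    "local_move [[], []] [[Over a s, Over b (- s)], [Under b (- s), Under a s]]"
| R3: "\<lbrakk>\<alpha> \<in> {1, -1}; \<beta> \<in> {1, -1}; \<gamma> \<in> {1, -1}; \<alpha> * sx = \<gamma> * sz; \<beta> * sx = \<gamma> * sy\<rbrakk> \<Longrightarrow>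
    local_move
      [strand \<alpha> (Over x sx) (Over y sy),
       strand \<beta> (Under x sx) (Over z sz),
       strand \<gamma> (Under y sy) (Under z sz)]
      [strand (- \<alpha>) (Over x sx) (Over y sy),
       strand (- \<beta>) (Under x sx) (Over z sz),
       strand (- \<gamma>) (Under y sy) (Under z sz)]"

text \<open>
  A template is a diagram with holes \<open>Inr 0, \<dots>, Inr (k - 1)\<close>, each occurring exactly once, marking
  the arcs on which a local move takes place.
\<close>

type_synonym diagram_template = "(endpoint + nat) list list"

definition has_holes :: "nat \<Rightarrow> diagram_template \<Rightarrow> bool" where
  "has_holes k T \<longleftrightarrow> (\<forall>i. count_list (concat T) (Inr i) = (if i < k then 1 else 0))"

definition fill :: "endpoint list list \<Rightarrow> diagram_template \<Rightarrow> diagram" where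
  "fill B T = map (\<lambda>w. concat (map (case_sum (\<lambda>e. [e]) (\<lambda>i. B ! i)) w)) T"

text \<open>
  Besides the local moves, the representation has to be made independent of the base points of
  the circles, of the labels of the chords, and of the order in which the circles are listed.
  In \<open>diagram_move D C D'\<close> the set \<open>C\<close> records which circle of \<open>D\<close> becomes which circle of \<open>D'\<close>.
\<close>

inductive diagram_move :: "diagram \<Rightarrow> (nat \<times> nat) set \<Rightarrow> diagram \<Rightarrow> bool" where
  local: "\<lbrakk>local_move B B'; has_holes (length B) T;
      gauss_diagram (fill B T); gauss_diagram (fill B' T)\<rbrakk> \<Longrightarrow>
    diagram_move (fill B T) (Id_on {..<length T}) (fill B' T)"
| rebase: "\<lbrakk>gauss_diagram D; i < length D\<rbrakk> \<Longrightarrow>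
    diagram_move D (Id_on {..<length D}) (D[i := rotate1 (D ! i)])"
| relabel: "\<lbrakk>gauss_diagram D; inj f\<rbrakk> \<Longrightarrow>
    diagram_move D (Id_on {..<length D}) (map (map (map_label f)) D)"
| reorder: "\<lbrakk>gauss_diagram D; bij_betw p {..<length D} {..<length D};
      length D' = length D; \<forall>i < length D. D' ! p i = D ! i\<rbrakk> \<Longrightarrow>
    diagram_move D {(i, p i) | i. i < length D} D'"


section \<open>Virtual knots\<close>

definition virtual_equiv :: "(diagram \<times> diagram) set" where
  "virtual_equiv = {(D, D'). equivclp (\<lambda>D D'. \<exists>C. diagram_move D C D') D D'}"

definition virtual_knots :: "diagram set set" where
  "virtual_knots = {D. knot_diagram D} // virtual_equiv"

definition unknot :: "diagram set" where
  "unknot = virtual_equiv `` {[[]]}"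

definition crossing_number :: "diagram set \<Rightarrow> nat" where
  "crossing_number K = (LEAST n. \<exists>D \<in> K. card (chords D) = n)"


section \<open>Cobordisms and the slice genus\<close>

datatype event = Reidemeister | Birth | Death | Saddle

text \<open>
  \<open>event_step e D C D'\<close>: the event \<open>e\<close> turns \<open>D\<close> into \<open>D'\<close>, and \<open>(i, j) \<in> C\<close> iff circle \<open>i\<close> of \<open>D\<close>
  and circle \<open>j\<close> of \<open>D'\<close> lie on the same component of the piece of surface traced out by the event.
  An oriented saddle cuts the diagram at two points and reconnects the ends in the other
  orientation-preserving way; any two points of a virtual link diagram can be made adjacent,
  suitably oriented, by moves that only involve virtual crossings. The circles and cut points can
  be brought into the positions used here by \<open>reorder\<close> and \<open>rebase\<close>.
\<close>

inductive event_step :: "event \<Rightarrow> diagram \<Rightarrow> (nat \<times> nat) set \<Rightarrow> diagram \<Rightarrow> bool" where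
  move: "diagram_move D C D' \<Longrightarrow> event_step Reidemeister D C D'"
| move_back: "diagram_move D C D' \<Longrightarrow> event_step Reidemeister D' (C\<inverse>) D"
| birth: "event_step Birth D (Id_on {..<length D}) (D @ [[]])"
| death: "event_step Death (D @ [[]]) (Id_on {..<length D}) D"
| merge: "event_step Saddle (D @ [u, v])
    (insert (Suc (length D), length D) (Id_on {..length D})) (D @ [u @ v])"
| split: "event_step Saddle (D @ [u @ v])
    (insert (length D, Suc (length D)) (Id_on {..length D})) (D @ [u, v])"

text \<open>
  A cobordism is given by frames \<open>F 0, \<dots>, F m\<close>, with event \<open>E t\<close> and correspondence \<open>C t\<close> between
  \<open>F t\<close> and \<open>F (Suc t)\<close>. The node \<open>(t, i)\<close> stands for circle \<open>i\<close> of the frame \<open>F t\<close>. The pieces of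
  surface traced out by the events are annuli, discs and pairs of pants, each bounded by at least
  one such circle, so that the surface is connected iff the graph formed by \<open>surface_nodes\<close> and
  \<open>surface_links\<close> is.
\<close>

definition surface_nodes :: "nat \<Rightarrow> (nat \<Rightarrow> diagram) \<Rightarrow> (nat \<times> nat) set" where
  "surface_nodes m F = {(t, i). t \<le> m \<and> i < length (F t)}"

definition surface_links ::
    "nat \<Rightarrow> (nat \<Rightarrow> (nat \<times> nat) set) \<Rightarrow> ((nat \<times> nat) \<times> (nat \<times> nat)) set" where
  "surface_links m C = {((t, i), (Suc t, j)) | t i j. t < m \<and> (i, j) \<in> C t}"

definition connected_surface ::
    "nat \<Rightarrow> (nat \<Rightarrow> diagram) \<Rightarrow> (nat \<Rightarrow> (nat \<times> nat) set) \<Rightarrow> bool" where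
  "connected_surface m F C \<longleftrightarrow>
     (\<forall>p \<in> surface_nodes m F. \<forall>q \<in> surface_nodes m F.
        (p, q) \<in> (surface_links m C \<union> (surface_links m C)\<inverse>)\<^sup>*)"

definition cobordism ::
    "diagram set \<Rightarrow> diagram set \<Rightarrow> nat \<Rightarrow> (nat \<Rightarrow> diagram) \<Rightarrow> (nat \<Rightarrow> event) \<Rightarrow>
     (nat \<Rightarrow> (nat \<times> nat) set) \<Rightarrow> bool" where
  "cobordism K K' m F E C \<longleftrightarrow>
     F 0 \<in> K \<and> F m \<in> K' \<and> (\<forall>t \<le> m. gauss_diagram (F t)) \<and>
     (\<forall>t < m. event_step (E t) (F t) (C t) (F (Suc t))) \<and>
     connected_surface m F C"

definition event_count :: "event \<Rightarrow> nat \<Rightarrow> (nat \<Rightarrow> event) \<Rightarrow> nat" where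
  "event_count e m E = card {t. t < m \<and> E t = e}"

definition cobordism_genus :: "nat \<Rightarrow> (nat \<Rightarrow> event) \<Rightarrow> real" where
  "cobordism_genus m E =
     (real (event_count Saddle m E) - real (event_count Birth m E)
        - real (event_count Death m E)) / 2"

text \<open>
  The surface of a cobordism between knots is connected and has two boundary circles and Euler
  characteristic \<open>b + d - s\<close>, so the genus of every cobordism is a natural number.
\<close>

definition slice_genus :: "diagram set \<Rightarrow> nat" where
  "slice_genus K =
     (LEAST g. \<exists>m F E C. cobordism K unknot m F E C \<and> real g = cobordism_genus m E)"

end

theory Submission
  imports Defs "HOL-Combinatorics.List_Permutation"
begin

text \<open>
  Represent \<open>K\<close> by a circle with \<open>n\<close> chords, and pair up its \<open>2 n\<close> chord endpoints by an involution
  \<open>\<mu>\<close>. An oriented saddle can make two given endpoints \<open>p\<close> and \<open>\<mu> p\<close> adjacent without separating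
  pairs that are adjacent already, so \<open>n\<close> saddles produce a diagram in which all matched endpoints
  are neighbours. If \<open>\<mu>\<close> matches the two ends of each chord, first Reidemeister moves now delete all
  chords. More generally, \<open>\<mu>\<close> may match the two overcrossing ends, and the two undercrossing ends, of
  two chords of opposite sign; such a pair of chords is deleted by a second Reidemeister move. What
  remains are \<open>k\<close> circles without chords. After \<open>k - 1\<close> deaths this is a connected surface from \<open>K\<close> to
  the unknot, of genus \<open>(n - (k - 1)) / 2\<close>. As \<open>k \<ge> 1\<close>, the slice genus is at most \<open>n / 2\<close>.

  If both signs occur, it remains to choose \<open>\<mu>\<close> with \<open>k \<ge> 2\<close>. Let \<open>\<sigma>\<close> send each endpoint to the next
  one on the circle. The final circles correspond to the cycles of \<open>\<sigma> \<circ> \<mu>\<close>, so what is needed is a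
  nonempty proper set \<open>J\<close> of endpoints invariant under \<open>\<sigma> \<circ> \<mu>\<close>. Let \<open>\<tau>\<close> match the ends of each chord.
  If \<open>\<sigma> \<circ> \<tau>\<close> has several cycles, take \<open>\<mu> = \<tau>\<close>. Otherwise \<open>\<sigma> \<circ> \<tau>\<close> is a second cyclic order on the
  endpoints. Matching the chords \<open>a\<close> and \<open>b\<close> of opposite signs with each other multiplies this long
  cycle by the transpositions exchanging \<open>Over a\<close> with \<open>Under b\<close> and \<open>Under a\<close> with \<open>Over b\<close>. It falls
  apart if the two transpositions do not cross in the second cyclic order. If they cross for all
  choices of \<open>a\<close> and \<open>b\<close>, then in that order chords of opposite signs do not cross, while every chord
  crosses some other chord, necessarily of its own sign. The first observation restricts the order so
  much that two crossing chords of one sign and two crossing chords of the other sign can be matched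
  with each other in such a way that the product with all four transpositions falls apart. This is
  \<open>splitting_rematching\<close>; the geometric part is \<open>slice_genus_rematching\<close>.

  During the saddles, the invariant set \<open>J\<close> is kept as a colouring of the arcs between endpoints: the arc
  that enters the endpoint \<open>p\<close> is coloured by whether \<open>p \<in> J\<close>, and the arc that leaves it by
  whether \<open>\<mu> p \<in> J\<close>. A circle without endpoints has one colour, and neither colour ever disappears, so
  two circles remain at least.
\<close>

section \<open>Chords of a Gauss diagram\<close>

fun opposite_end :: "endpoint \<Rightarrow> endpoint" where
  "opposite_end (Over a s) = Under a s"
| "opposite_end (Under a s) = Over a s"

lemma opposite_end_simps [simp]:
  "opposite_end (opposite_end e) = e" "csign (opposite_end e) = csign e"
  "label (opposite_end e) = label e" "is_Over (opposite_end e) \<longleftrightarrow> \<not> is_Over e"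
  by (cases e; simp)+

text \<open>
  The arguments below keep passing from one end of a chord to the other, hence this form in terms
  of closure under \<open>opposite_end\<close>.
\<close>

lemma gauss_diagram_iff:
  "gauss_diagram D \<longleftrightarrow> distinct (concat D) \<and>
     (\<forall>e\<in>set (concat D). opposite_end e \<in> set (concat D) \<and> csign e \<in> {1, -1} \<and>
        (\<forall>e'\<in>set (concat D). label e' = label e \<longrightarrow> csign e' = csign e))"
proof
  assume g: "gauss_diagram D"
  have o: "opposite_end e \<in> set (concat D)" "Over (label e) (csign e) \<in> set (concat D)"
    if "e \<in> set (concat D)" for e
    using g that unfolding gauss_diagram_def by (cases e; auto)+
  have "csign e' = csign e"
    if "e \<in> set (concat D)" "e' \<in> set (concat D)" "label e' = label e" for e e'
    using g o(2)[OF that(1)] o(2)[OF that(2)] that(3) unfolding gauss_diagram_def by metis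
  moreover have "distinct (concat D)" "\<forall>e\<in>set (concat D). csign e \<in> {1, -1}"
    using g unfolding gauss_diagram_def by blast+
  ultimately show "distinct (concat D) \<and>
     (\<forall>e\<in>set (concat D). opposite_end e \<in> set (concat D) \<and> csign e \<in> {1, -1} \<and>
        (\<forall>e'\<in>set (concat D). label e' = label e \<longrightarrow> csign e' = csign e))"
    using o(1) by blast
next
  assume g: "distinct (concat D) \<and>
     (\<forall>e\<in>set (concat D). opposite_end e \<in> set (concat D) \<and> csign e \<in> {1, -1} \<and>
        (\<forall>e'\<in>set (concat D). label e' = label e \<longrightarrow> csign e' = csign e))"
  then have o: "opposite_end e \<in> set (concat D)" and c: "csign e \<in> {1, -1}"
    and l: "e' \<in> set (concat D) \<Longrightarrow> label e' = label e \<Longrightarrow> csign e' = csign e"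
    if "e \<in> set (concat D)" for e e'
    using that by blast+
  have "Over a s \<in> set (concat D) \<longleftrightarrow> Under a s \<in> set (concat D)" for a s
    using o[of "Over a s"] o[of "Under a s"] by (auto simp del: set_concat)
  moreover have "s = t" if "Over a s \<in> set (concat D)" "Over a t \<in> set (concat D)" for a s t
    using l[OF that] by simp
  ultimately show "gauss_diagram D"
    using g c unfolding gauss_diagram_def by blast
qed

lemma gauss_diagram_opposite_end:
  "gauss_diagram D \<Longrightarrow> e \<in> set (concat D) \<Longrightarrow> opposite_end e \<in> set (concat D)"
  unfolding gauss_diagram_iff by blast

lemma gauss_diagram_mset:
  assumes "gauss_diagram D" "mset (concat D') = mset (concat D)"
  shows "gauss_diagram D'"
proof -
  have "set (concat D') = set (concat D)" "distinct (concat D') = distinct (concat D)"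
    using assms(2) mset_eq_setD mset_eq_imp_distinct_iff by blast+
  then have "gauss_diagram D' = gauss_diagram D"
    unfolding gauss_diagram_def by (simp only:)
  then show ?thesis
    using assms(1) by simp
qed

lemma mset_concat_cong: "mset Ws = mset Vs \<Longrightarrow> mset (concat Ws) = mset (concat Vs)"
  by (simp add: mset_concat) (metis mset_map sum_mset_sum_list)

lemma gauss_diagram_subset:
  assumes "gauss_diagram D" "distinct (concat D')" "set (concat D') \<subseteq> set (concat D)"
    "\<And>e. e \<in> set (concat D') \<Longrightarrow> opposite_end e \<in> set (concat D')"
  shows "gauss_diagram D'"
  using assms(2,4) assms(1,3)[unfolded gauss_diagram_iff]
  unfolding gauss_diagram_iff[of D'] subset_iff by blast

lemma opposite_end_map_label [simp]:
  "opposite_end (map_label f e) = map_label f (opposite_end e)"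
  "csign (map_label f e) = csign e" "label (map_label f e) = f (label e)"
  by (cases e; simp)+

lemma inj_map_label: "inj f \<Longrightarrow> inj (map_label f)"
proof (rule injI)
  show "x = y" if "inj f" "map_label f x = map_label f y" for x y
    using that by (cases x; cases y) (auto dest: injD)
qed

lemma gauss_diagram_relabel:
  assumes g: "gauss_diagram D" and f: "inj f"
  shows "gauss_diagram (map (map (map_label f)) D)"
proof -
  have c: "concat (map (map (map_label f)) D) = map (map_label f) (concat D)"
    by (simp add: map_concat)
  show ?thesis
    unfolding gauss_diagram_iff c set_map ball_simps
    by (simp only: opposite_end_map_label inj_image_mem_iff[OF inj_map_label[OF f]] inj_eq[OF f]
        distinct_map inj_on_subset[OF inj_map_label[OF f] subset_UNIV] simp_thms
        g[unfolded gauss_diagram_iff])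
      (rule conjunct2[OF g[unfolded gauss_diagram_iff]])
qed

text \<open>
  Why all representatives of a virtual knot are Gauss diagrams on a single circle.
\<close>

lemma diagram_move_gauss:
  assumes "diagram_move D C D'"
  shows "gauss_diagram D \<and> gauss_diagram D' \<and> length D' = length D"
  using assms
proof cases
  case (local B B' T)
  then show ?thesis by (simp add: fill_def)
next
  case (rebase i)
  have "mset (concat (D[i := rotate1 (D ! i)])) = mset (concat D)"
  proof -
    have "D = take i D @ D ! i # drop (Suc i) D"
      using rebase by (simp add: id_take_nth_drop)
    moreover have "D[i := rotate1 (D ! i)] = take i D @ rotate1 (D ! i) # drop (Suc i) D"
      using rebase by (simp add: upd_conv_take_nth_drop)
    moreover have "mset (rotate1 w) = mset w" for w :: "endpoint list"
      by (cases w) auto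
    ultimately show ?thesis
      by (metis (no_types, lifting) concat.simps(2) concat_append mset_append)
  qed
  then show ?thesis
    using rebase gauss_diagram_mset by simp
next
  case (relabel f)
  then show ?thesis using gauss_diagram_relabel by simp
next
  case (reorder p)
  have "mset D' = mset D"
  proof -
    have "mset D' = image_mset ((!) D') (mset_set {..<length D'})"
      by (metis lessThan_atLeast0 map_nth mset_map mset_upt)
    also have "mset_set {..<length D'} = image_mset p (mset_set {..<length D})"
      using reorder bij_betw_imp_inj_on bij_betw_imp_surj_on
      by (metis image_mset_mset_set)
    also have "image_mset ((!) D') (image_mset p (mset_set {..<length D})) =
        image_mset ((!) D) (mset_set {..<length D})"
      unfolding image_mset.compositionality
      by (rule image_mset_cong) (use reorder in auto)
    also have "\<dots> = mset D"
      by (metis lessThan_atLeast0 map_nth mset_map mset_upt)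
    finally show ?thesis .
  qed
  then show ?thesis
    using reorder gauss_diagram_mset mset_concat_cong by metis
qed

lemma virtual_equiv_gauss:
  assumes "(D, D') \<in> virtual_equiv"
  shows "length D' = length D \<and> gauss_diagram D' = gauss_diagram D"
proof -
  have "equivclp (\<lambda>D D'. \<exists>C. diagram_move D C D') D D'"
    using assms by (simp add: virtual_equiv_def)
  then show ?thesis
  proof (induction rule: equivclp_induct)
    case (step D' D'')
    then show ?case using diagram_move_gauss by metis
  qed simp
qed

lemma card_chords:
  assumes "gauss_diagram D"
  shows "card (set (concat D)) = 2 * card (chords D)"
proof -
  let ?X = "set (concat D)" and ?o = "\<lambda>(a, s). Over a s" and ?u = "\<lambda>(a, s). Under a s"
  have "chords D = (\<lambda>e. (label e, csign e)) ` {e \<in> ?X. is_Over e}"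
    unfolding chords_def by (force simp: image_iff is_Over_def)
  then have fin: "finite (chords D)" by simp
  have X: "?X = ?o ` chords D \<union> ?u ` chords D"
  proof
    show "?X \<subseteq> ?o ` chords D \<union> ?u ` chords D"
    proof
      fix e assume e: "e \<in> ?X"
      show "e \<in> ?o ` chords D \<union> ?u ` chords D"
      proof (cases e)
        case (Over a s)
        then show ?thesis using e unfolding chords_def by (force simp: image_iff)
      next
        case (Under a s)
        then have "(a, s) \<in> chords D" 
          using assms e unfolding chords_def gauss_diagram_def by blast
        then show ?thesis using Under by force
      qed
    qed
    show "?o ` chords D \<union> ?u ` chords D \<subseteq> ?X"
      using assms unfolding chords_def gauss_diagram_def by auto
  qed
  have "card (?o ` chords D) = card (chords D)" "card (?u ` chords D) = card (chords D)"
    by (auto intro!: card_image inj_onI)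
  moreover have "?o ` chords D \<inter> ?u ` chords D = {}"
    by auto
  ultimately show ?thesis
    unfolding X using fin by (simp add: card_Un_disjoint)
qed

section \<open>Cobordisms without births\<close>

text \<open>
  The numbers count the saddles and the deaths. Without births every component of the surface
  reaches back to the first frame, so that
  connectedness is automatic when that frame is a single circle.
\<close>

inductive descent :: "nat \<Rightarrow> nat \<Rightarrow> diagram \<Rightarrow> diagram \<Rightarrow> bool" where
  refl: "gauss_diagram D \<Longrightarrow> descent 0 0 D D"
| step: "descent s d D D' \<Longrightarrow> event_step e D' C D'' \<Longrightarrow> e \<noteq> Birth \<Longrightarrow> gauss_diagram D'' \<Longrightarrow>
    descent (s + of_bool (e = Saddle)) (d + of_bool (e = Death)) D D''"

lemma descent_gauss: "descent s d D D' \<Longrightarrow> gauss_diagram D \<and> gauss_diagram D'"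
  by (induction rule: descent.induct) auto

lemma descent_trans:
  assumes "descent s' d' D' D''" "descent s d D D'"
  shows "descent (s + s') (d + d') D D''"
  using assms
proof (induction rule: descent.induct)
  case (step s' d' D' E e C F)
  show ?case
    using descent.step[OF step.IH[OF step.prems] step.hyps(2-4)] by (simp add: add.assoc)
qed simp

lemma descent_step:
  assumes "event_step e D C D'" "e \<noteq> Birth" "gauss_diagram D" "gauss_diagram D'"
  shows "descent (of_bool (e = Saddle)) (of_bool (e = Death)) D D'"
  using descent.step[OF descent.refl[OF assms(3)] assms(1,2,4)] by simp

lemma descent_Reidemeister:
  assumes "diagram_move D C D' \<or> diagram_move D' C D"
  shows "descent 0 0 D D'"
  using descent_step[of Reidemeister D _ D'] move move_back diagram_move_gauss assms by fastforce

lemma event_step_covers: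
  assumes "event_step e D C D'" "e \<noteq> Birth" "j < length D'"
  shows "\<exists>i<length D. (i, j) \<in> C"
  using assms
proof cases
  case move
  from move(2) show ?thesis
  proof cases
    case (local B B' T)
    then show ?thesis using assms(3) by (auto simp: fill_def Id_on_iff)
  next
    case (reorder p)
    then have "j \<in> p ` {..<length D}"
      using assms(3) by (simp add: bij_betw_def)
    then obtain i where "i < length D" "p i = j"
      by auto
    then show ?thesis using reorder by auto
  qed (use assms(3) in \<open>auto simp: Id_on_iff\<close>)
next
  case (move_back C')
  from move_back(3) show ?thesis
  proof cases
    case (local B B' T)
    then show ?thesis using assms(3) move_back by (auto simp: fill_def Id_on_iff)
  next
    case (reorder p)
    then have "p j < length D"
      using assms(3) bij_betwE[of p "{..<length D'}" "{..<length D'}"] by simp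
    then show ?thesis using reorder move_back assms(3) by auto
  qed (use assms(3) move_back in \<open>auto simp: Id_on_iff\<close>)
next
  case death
  then show ?thesis using assms(3) by (auto simp: Id_on_iff)
next
  case (merge E u v)
  then show ?thesis using assms(3) by (auto simp: Id_on_iff intro!: exI[of _ j])
next
  case (split E u v)
  then show ?thesis using assms(3) 
    by (cases "j = Suc (length E)") (auto simp: Id_on_iff intro!: exI[of _ "if j = Suc (length E) then length E else j"])
qed simp_all

lemma event_count_Suc:
  "event_count e (Suc m) (E(m := f)) = event_count e m E + of_bool (f = e)"
proof -
  have "{t. t < Suc m \<and> (E(m := f)) t = e} = {t. t < m \<and> E t = e} \<union> (if f = e then {m} else {})"
    by (auto simp: less_Suc_eq)
  then show ?thesis
    by (simp add: event_count_def)
qed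

lemma descent_frames:
  assumes "descent s d D D'"
  shows "\<exists>m F E C. F 0 = D \<and> F m = D' \<and> (\<forall>t\<le>m. gauss_diagram (F t)) \<and>
    (\<forall>t<m. event_step (E t) (F t) (C t) (F (Suc t)) \<and> E t \<noteq> Birth) \<and>
    event_count Saddle m E = s \<and> event_count Birth m E = 0 \<and> event_count Death m E = d"
  using assms
proof (induction rule: descent.induct)
  case (refl D)
  then show ?case
    by (intro exI[of _ 0] exI[of _ "\<lambda>_. D"]) (auto simp: event_count_def)
next
  case (step s d D D' e C D'')
  then obtain m F E K where *: "F 0 = D" "F m = D'" "\<forall>t\<le>m. gauss_diagram (F t)"
    "\<forall>t<m. event_step (E t) (F t) (K t) (F (Suc t)) \<and> E t \<noteq> Birth"
    "event_count Saddle m E = s" "event_count Birth m E = 0" "event_count Death m E = d"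
    by blast
  show ?case
    by (rule exI[of _ "Suc m"], rule exI[of _ "F(Suc m := D'')"], rule exI[of _ "E(m := e)"],
        rule exI[of _ "K(m := C)"],
        unfold event_count_Suc)
      (use * step.hyps in \<open>auto simp: le_Suc_eq less_Suc_eq\<close>)
qed

text \<open>
  Following a circle backwards through the frames ends at the only circle of the first frame.
\<close>

lemma connected_surfaceI:
  assumes len: "length (F 0) = 1"
    and cover: "\<And>t j. t < m \<Longrightarrow> j < length (F (Suc t)) \<Longrightarrow> \<exists>i<length (F t). (i, j) \<in> C t"
  shows "connected_surface m F C"
proof -
  let ?R = "surface_links m C \<union> (surface_links m C)\<inverse>"
  have root: "((0, 0), (t, i)) \<in> ?R\<^sup>*" if "t \<le> m" "i < length (F t)" for t i
    using that
  proof (induction t arbitrary: i)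
    case 0
    then show ?case using len by simp
  next
    case (Suc t)
    then obtain k where "k < length (F t)" "(k, i) \<in> C t"
      using cover[of t i] by auto
    moreover from this have "((t, k), (Suc t, i)) \<in> ?R"
      using Suc.prems by (auto simp: surface_links_def)
    ultimately show ?case
      using Suc by (meson Suc_leD rtrancl.rtrancl_into_rtrancl)
  qed
  have "sym ?R" by (auto simp: sym_def)
  then have "sym (?R\<^sup>*)" by (rule sym_rtrancl)
  then show ?thesis
    unfolding connected_surface_def surface_nodes_def
    using rtrancl_trans[OF symD[OF _ root] root] by auto
qed

text \<open>
  The equation \<open>s = 2 * g + d\<close> exhibits the genus \<open>(s - d) / 2\<close> as the natural number \<open>g\<close>, as the least
  number in the definition of the slice genus has to be compared with it.
\<close>

lemma slice_genus_le:
  assumes "descent s d D [[]]" "D \<in> K" "length D = 1" "s = 2 * g + d"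
  shows "slice_genus K \<le> g"
proof -
  obtain m F E C where *: "F 0 = D" "F m = [[]]" "\<forall>t\<le>m. gauss_diagram (F t)"
    "\<forall>t<m. event_step (E t) (F t) (C t) (F (Suc t)) \<and> E t \<noteq> Birth"
    "event_count Saddle m E = s" "event_count Birth m E = 0" "event_count Death m E = d"
    using descent_frames[OF assms(1)] by blast
  have "connected_surface m F C"
    by (rule connected_surfaceI) (use * assms(3) event_step_covers in blast)+
  moreover have "[[]] \<in> unknot"
    by (simp add: unknot_def virtual_equiv_def)
  ultimately have "cobordism K unknot m F E C"
    using * assms(2) by (simp add: cobordism_def)
  moreover have "real g = cobordism_genus m E"
    using * assms(4) by (simp add: cobordism_genus_def)
  ultimately show ?thesis
    unfolding slice_genus_def by (intro Least_le) blast
qed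

lemma descent_deaths:
  "descent 0 k (replicate (Suc k) []) [[]]"
proof (induction k)
  case 0
  then show ?case using descent.refl[of "[[]]"] by (simp add: gauss_diagram_iff)
next
  case (Suc k)
  have "descent 0 1 (replicate (Suc k) [] @ [[]]) (replicate (Suc k) [])"
    using descent_step[OF event_step.death[of "replicate (Suc k) []"]]
    by (simp add: gauss_diagram_iff)
  from descent_trans[OF Suc this] show ?case
    by (simp add: replicate_append_same)
qed

section \<open>Saddles on families of cyclic words\<close>

text \<open>
  Saddles only cut and reglue cyclic words, whatever their letters are, and the invariants of this
  process do not involve Gauss diagrams.
\<close>

inductive surgery :: "nat \<Rightarrow> 'a list list \<Rightarrow> 'a list list \<Rightarrow> bool" where
  refl: "surgery 0 W W"
| rotate: "surgery s W (V @ [x @ y]) \<Longrightarrow> surgery s W (V @ [y @ x])"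
| permute: "surgery s W V \<Longrightarrow> mset V' = mset V \<Longrightarrow> surgery s W V'"
| split: "surgery s W (V @ [x @ y]) \<Longrightarrow> surgery (Suc s) W (V @ [x, y])"
| merge: "surgery s W (V @ [x, y]) \<Longrightarrow> surgery (Suc s) W (V @ [x @ y])"

lemma surgery_trans:
  assumes "surgery s' V W" "surgery s U V"
  shows "surgery (s + s') U W"
  using assms by (induction rule: surgery.induct) (auto intro: surgery.intros)

lemma surgery_mset: "surgery s W V \<Longrightarrow> mset (concat V) = mset (concat W)"
  by (induction rule: surgery.induct) (auto dest: mset_concat_cong simp: union_commute)

text \<open>
  A saddle splits or merges circles. The number \<open>m\<close> of mergers will be the genus of the cobordism that
  is finally constructed, which settles the parity question in the definition of the slice genus.
\<close>

lemma surgery_length: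
  "surgery s W V \<Longrightarrow> \<exists>m. length W + s = length V + 2 * m"
proof (induction rule: surgery.induct)
  case (permute s W V V')
  then show ?case by (metis mset_eq_length)
next
  case (merge s W V x y)
  then obtain m where "length W + s = length (V @ [x, y]) + 2 * m" by blast
  then show ?case by (intro exI[of _ "Suc m"]) simp
qed auto

lemma descent_rotate:
  assumes "gauss_diagram (V @ [x @ y])"
  shows "descent 0 0 (V @ [x @ y]) (V @ [y @ x])"
  using assms
proof (induction x arbitrary: y)
  case Nil
  then show ?case using descent.refl by simp
next
  case (Cons a x)
  have "diagram_move (V @ [(a # x) @ y]) (Id_on {..<Suc (length V)}) (V @ [x @ y @ [a]])"
    using diagram_move.rebase[OF Cons.prems, of "length V"] by simp
  then have "descent 0 0 (V @ [(a # x) @ y]) (V @ [x @ y @ [a]])" 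
      "gauss_diagram (V @ [x @ y @ [a]])"
    using descent_Reidemeister diagram_move_gauss by blast+
  from descent_trans[OF Cons.IH[OF this(2)] this(1)] show ?case
    by simp
qed

lemma descent_permute:
  assumes "gauss_diagram V" "mset V' = mset V"
  shows "descent 0 0 V V'"
proof -
  obtain p where p: "bij_betw p {..<length V} {..<length V'}" "\<forall>i<length V. V ! i = V' ! p i"
    using permutation_Ex_bij[of V V'] assms(2) by auto
  then have "diagram_move V {(i, p i) |i. i < length V} V'"
    using assms mset_eq_length[OF assms(2)] by (intro diagram_move.reorder) auto
  then show ?thesis
    using descent_Reidemeister by blast
qed

lemma surgery_descent:
  assumes "surgery s D D'" "gauss_diagram D"
  shows "descent s 0 D D'"
  using assms
proof (induction rule: surgery.induct)
  case (refl W)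
  then show ?case by (rule descent.refl)
next
  case (rotate s W V x y)
  then have "descent s 0 W (V @ [x @ y])" by blast
  from descent_trans[OF descent_rotate this] descent_gauss[OF this] show ?case
    by simp
next
  case (permute s W V V')
  then have "descent s 0 W V" by blast
  from descent_trans[OF descent_permute this] descent_gauss[OF this] permute.hyps(2) show ?case
    by simp
next
  case (split s W V x y)
  then have "descent s 0 W (V @ [x @ y])" by blast
  from descent.step[OF this event_step.split] descent_gauss[OF this] show ?case
    using gauss_diagram_mset[of "V @ [x @ y]" "V @ [x, y]"] by simp
next
  case (merge s W V x y)
  then have "descent s 0 W (V @ [x, y])" by blast
  from descent.step[OF this event_step.merge] descent_gauss[OF this] show ?case
    using gauss_diagram_mset[of "V @ [x, y]" "V @ [x @ y]"] by simp
qed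

section \<open>Rematching chords of opposite signs\<close>

text \<open>
  A transitive permutation of a finite set is a single cycle. Its elements are numbered from a base
  point \<open>x\<close>, the element with the largest number being mapped back to \<open>x\<close>.
\<close>

lemma cyclic_rank:
  assumes fin: "finite X" and maps: "\<And>y. y \<in> X \<Longrightarrow> f y \<in> X" and inj: "inj_on f X" and x: "x \<in> X"
    and trans: "\<And>J. (\<And>y. y \<in> X \<Longrightarrow> f y \<in> J \<longleftrightarrow> y \<in> J) \<Longrightarrow> x \<in> J \<Longrightarrow> X \<subseteq> J"
  obtains r :: "'a \<Rightarrow> nat" where "inj_on r X" "r x = 0"
    "\<And>y. y \<in> X \<Longrightarrow> f y \<noteq> x \<Longrightarrow> r (f y) = Suc (r y)"
    "\<And>y z. y \<in> X \<Longrightarrow> z \<in> X \<Longrightarrow> f y = x \<Longrightarrow> r z \<le> r y"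
proof -
  define J where "J = range (\<lambda>k. (f ^^ k) x)"
  have iter: "(f ^^ k) x \<in> X" for k
    by (induction k) (auto simp: x maps)
  have JX: "J \<subseteq> X"
    using iter by (auto simp: J_def)
  have fJ: "f ` J \<subseteq> J"
  proof
    fix y assume "y \<in> f ` J"
    then obtain k where "y = (f ^^ Suc k) x"
      by (auto simp: J_def)
    then show "y \<in> J"
      unfolding J_def by blast
  qed
  \<comment> \<open>The orbit of \<open>x\<close> is closed under preimages because \<open>f\<close> permutes it.\<close>
  have "f ` J = J"
    using endo_inj_surj[OF finite_subset[OF JX fin] fJ inj_on_subset[OF inj JX]] .
  then have "f y \<in> J \<longleftrightarrow> y \<in> J" if "y \<in> X" for y
    using inj_on_image_mem_iff[OF inj that JX] by simp
  moreover have "x \<in> J"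
    unfolding J_def by (rule range_eqI[of _ _ 0]) simp
  ultimately have XJ: "X \<subseteq> J"
    by (rule trans)
  define r where "r y = (LEAST k. (f ^^ k) x = y)" for y
  have r_le: "r ((f ^^ k) x) \<le> k" for k
    unfolding r_def by (rule Least_le) simp
  have r: "(f ^^ r y) x = y" if "y \<in> X" for y
  proof -
    have "y \<in> J" using that XJ by blast
    then obtain k where "(f ^^ k) x = y"
      by (auto simp: J_def)
    then show ?thesis
      unfolding r_def by (rule LeastI)
  qed
  show thesis
  proof
    show "inj_on r X"
      using r by (metis inj_onI)
    show "r x = 0"
      using r_le[of 0] by simp
    show "r (f y) = Suc (r y)" if y: "y \<in> X" "f y \<noteq> x" for y
    proof -
      obtain j where j: "r (f y) = Suc j"
        using r[OF maps[OF y(1)]] y(2) by (cases "r (f y)") auto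
      have "f ((f ^^ j) x) = f y"
        using r[OF maps[OF y(1)]] j by simp
      then have "(f ^^ j) x = y"
        using inj iter y(1) by (meson inj_onD)
      then have "r y \<le> j"
        using r_le[of j] by simp
      moreover have "r (f y) \<le> Suc (r y)"
        using r_le[of "Suc (r y)"] r[OF y(1)] by simp
      ultimately show ?thesis
        using j by simp
    qed
    show "r z \<le> r y" if y: "y \<in> X" and z: "z \<in> X" and fy: "f y = x" for y z
    proof -
      have "(f ^^ Suc (r y)) x = x"
        using r[OF y] fy by simp
      then have "(f ^^ (r z mod Suc (r y))) x = z"
        using r[OF z] by (metis funpow_mod_eq)
      then have "r z \<le> r z mod Suc (r y)"
        using r_le by metis
      also have "\<dots> < Suc (r y)"
        by simp
      finally show ?thesis by simp
    qed
  qed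
qed

text \<open>
  The matchings whose pairs can be removed by Reidemeister moves, once matched endpoints are
  adjacent. \<open>\<tau>\<close> exchanges the ends of a chord, \<open>P\<close> holds at the ends of positive chords, and \<open>T\<close> tells
  the two ends of a chord apart.
\<close>

definition rematching ::
    "'a set \<Rightarrow> ('a \<Rightarrow> 'a) \<Rightarrow> ('a \<Rightarrow> bool) \<Rightarrow> ('a \<Rightarrow> bool) \<Rightarrow> ('a \<Rightarrow> 'a) \<Rightarrow> bool" where
  "rematching X \<tau> P T \<mu> \<longleftrightarrow> (\<forall>x\<in>X. \<mu> x \<in> X \<and> \<mu> (\<mu> x) = x \<and>
     (\<mu> x = \<tau> x \<or> P (\<mu> x) \<noteq> P x \<and> T (\<mu> x) = T x \<and> \<mu> (\<tau> x) = \<tau> (\<mu> x)))"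

text \<open>
  Chords on one oriented circle: \<open>\<sigma>\<close> is the successor along the circle, and \<open>one_circle\<close> says that it
  acts transitively on the endpoints.
\<close>

locale chord_circle =
  fixes X :: "'a set" and \<sigma> \<tau> :: "'a \<Rightarrow> 'a" and P T :: "'a \<Rightarrow> bool"
  assumes fin: "finite X"
    and succ_in: "x \<in> X \<Longrightarrow> \<sigma> x \<in> X"
    and succ_inj: "inj_on \<sigma> X"
    and one_circle: "(\<And>x. x \<in> X \<Longrightarrow> \<sigma> x \<in> J \<longleftrightarrow> x \<in> J) \<Longrightarrow> x \<in> X \<Longrightarrow> x \<in> J \<Longrightarrow> X \<subseteq> J"
    and opp_in: "x \<in> X \<Longrightarrow> \<tau> x \<in> X"
    and opp_opp: "x \<in> X \<Longrightarrow> \<tau> (\<tau> x) = x"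
    and opp_sign: "x \<in> X \<Longrightarrow> P (\<tau> x) = P x"
    and opp_kind: "x \<in> X \<Longrightarrow> T (\<tau> x) \<longleftrightarrow> \<not> T x"
begin

text \<open>
  A proper nonempty union \<open>J\<close> of cycles of \<open>\<sigma> \<circ> \<mu>\<close>.
\<close>

definition splits :: "('a \<Rightarrow> 'a) \<Rightarrow> 'a set \<Rightarrow> bool" where
  "splits \<mu> J \<longleftrightarrow> (\<forall>x\<in>X. \<sigma> (\<mu> x) \<in> J \<longleftrightarrow> x \<in> J) \<and> (\<exists>x\<in>X. x \<in> J) \<and> (\<exists>x\<in>X. x \<notin> J)"

text \<open>
  If \<open>x\<close> and \<open>z\<close> lie on different chords and \<open>T x \<noteq> T z\<close>, then \<open>\<tau> \<circ> switch x z\<close> matches the chord of \<open>x\<close> with the chord of \<open>z\<close>: it sends \<open>x\<close> to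
  \<open>\<tau> z\<close>, which is an end of the same kind as \<open>x\<close>.
\<close>

definition switch :: "'a \<Rightarrow> 'a \<Rightarrow> 'a \<Rightarrow> 'a" where
  "switch x z m = (if m = x then z else if m = z then x else
     if m = \<tau> x then \<tau> z else if m = \<tau> z then \<tau> x else m)"

text \<open>
  The involutions \<open>\<pi>\<close> for which \<open>\<tau> \<circ> \<pi>\<close> is a rematching. The permutation to be split becomes
  \<open>(\<sigma> \<circ> \<tau>) \<circ> \<pi>\<close>, a fixed permutation multiplied by transpositions.
\<close>

definition switchable :: "('a \<Rightarrow> 'a) \<Rightarrow> bool" where
  "switchable \<pi> \<longleftrightarrow> (\<forall>x\<in>X. \<pi> x \<in> X \<and> \<pi> (\<pi> x) = x \<and> \<pi> (\<tau> x) = \<tau> (\<pi> x) \<and>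
     (\<pi> x = x \<or> P (\<pi> x) \<noteq> P x \<and> T (\<pi> x) \<noteq> T x))"

lemma rematching_switchable:
  assumes "switchable \<pi>"
  shows "rematching X \<tau> P T (\<tau> \<circ> \<pi>)"
  unfolding rematching_def
proof
  fix x assume x: "x \<in> X"
  have p: "\<pi> x \<in> X" "\<pi> (\<pi> x) = x" "\<pi> (\<tau> x) = \<tau> (\<pi> x)"
      "\<pi> x = x \<or> P (\<pi> x) \<noteq> P x \<and> T (\<pi> x) \<noteq> T x" "\<pi> (\<tau> (\<pi> x)) = \<tau> (\<pi> (\<pi> x))"
    using assms x unfolding switchable_def by auto
  show "(\<tau> \<circ> \<pi>) x \<in> X \<and> (\<tau> \<circ> \<pi>) ((\<tau> \<circ> \<pi>) x) = x \<and>
     ((\<tau> \<circ> \<pi>) x = \<tau> x \<or> P ((\<tau> \<circ> \<pi>) x) \<noteq> P x \<and> T ((\<tau> \<circ> \<pi>) x) = T x \<and>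
       (\<tau> \<circ> \<pi>) (\<tau> x) = \<tau> ((\<tau> \<circ> \<pi>) x))"
    using p opp_in[OF p(1)] opp_opp[OF x] opp_opp[OF p(1)] opp_sign[OF p(1)] opp_kind[OF p(1)] x
    by auto
qed

lemma switchable_switch:
  assumes "x \<in> X" "z \<in> X" "P x \<noteq> P z" "T x \<noteq> T z"
  shows "switchable (switch x z)"
proof -
  have d: "x \<noteq> z" "\<tau> x \<noteq> \<tau> z" "x \<noteq> \<tau> x" "z \<noteq> \<tau> z" "x \<noteq> \<tau> z" "z \<noteq> \<tau> x"
    using assms opp_opp opp_sign opp_kind by metis+
  show ?thesis
    unfolding switchable_def
  proof
    fix m assume m: "m \<in> X"
    consider "m = x" | "m = z" | "m = \<tau> x" | "m = \<tau> z"
      | "m \<noteq> x" "m \<noteq> z" "m \<noteq> \<tau> x" "m \<noteq> \<tau> z"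
      by blast
    then show "switch x z m \<in> X \<and> switch x z (switch x z m) = m \<and>
        switch x z (\<tau> m) = \<tau> (switch x z m) \<and>
        (switch x z m = m \<or> P (switch x z m) \<noteq> P m \<and> T (switch x z m) \<noteq> T m)"
    proof cases
      case 5
      then have "\<tau> m \<noteq> x" "\<tau> m \<noteq> z" "\<tau> m \<noteq> \<tau> x" "\<tau> m \<noteq> \<tau> z"
        using assms(1,2) m opp_opp by metis+
      then show ?thesis
        using 5 m by (simp add: switch_def)
    qed (use d assms in \<open>simp_all add: switch_def opp_in opp_opp opp_sign opp_kind\<close>)
  qed
qed

lemma switchable_comp:
  assumes "switchable \<pi>" "switchable \<rho>" "\<And>m. m \<in> X \<Longrightarrow> \<pi> m = m \<or> \<rho> m = m"
  shows "switchable (\<pi> \<circ> \<rho>)"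
  unfolding switchable_def
proof
  fix m assume m: "m \<in> X"
  have p: "\<pi> y \<in> X" "\<pi> (\<pi> y) = y" "\<pi> (\<tau> y) = \<tau> (\<pi> y)"
      "\<pi> y = y \<or> P (\<pi> y) \<noteq> P y \<and> T (\<pi> y) \<noteq> T y" if "y \<in> X" for y
    using assms(1) that unfolding switchable_def by auto
  have q: "\<rho> y \<in> X" "\<rho> (\<rho> y) = y" "\<rho> (\<tau> y) = \<tau> (\<rho> y)"
      "\<rho> y = y \<or> P (\<rho> y) \<noteq> P y \<and> T (\<rho> y) \<noteq> T y" if "y \<in> X" for y
    using assms(2) that unfolding switchable_def by auto
  have comm: "\<pi> (\<rho> y) = \<rho> (\<pi> y)" if y: "y \<in> X" for y
    using assms(3) p q y by metis
  show "(\<pi> \<circ> \<rho>) m \<in> X \<and> (\<pi> \<circ> \<rho>) ((\<pi> \<circ> \<rho>) m) = m \<and> (\<pi> \<circ> \<rho>) (\<tau> m) = \<tau> ((\<pi> \<circ> \<rho>) m) \<and>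
      ((\<pi> \<circ> \<rho>) m = m \<or> P ((\<pi> \<circ> \<rho>) m) \<noteq> P m \<and> T ((\<pi> \<circ> \<rho>) m) \<noteq> T m)"
    using m p q comm assms(3)[OF m] assms(3)[OF q(1)[OF m]] by (smt (verit) comp_apply)
qed

lemma smoothing_inj: "inj_on (\<sigma> \<circ> \<tau>) X"
proof (rule comp_inj_on)
  show "inj_on \<tau> X" using opp_opp by (metis inj_onI)
  show "inj_on \<sigma> (\<tau> ` X)" using succ_inj opp_in by (metis image_subsetI inj_on_subset)
qed

end

text \<open>
  Now \<open>\<sigma> \<circ> \<tau>\<close> is assumed to be a single cycle, and \<open>r\<close> numbers the endpoints along it. The numbering
  starts at a place where the sign changes from the last endpoint \<open>y0\<close> to the first endpoint \<open>x0\<close>. With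
  this choice the critical configuration appears in one linear order, instead of one for every position
  of the base point.
\<close>

locale ranked_chord_circle = chord_circle +
  fixes r :: "'a \<Rightarrow> nat" and x0 y0 :: 'a
  assumes rank_inj: "inj_on r X"
    and base: "x0 \<in> X" "r x0 = 0"
    and final: "y0 \<in> X" "\<sigma> (\<tau> y0) = x0" "P y0 \<noteq> P x0"
    and rank_Suc: "y \<in> X \<Longrightarrow> \<sigma> (\<tau> y) \<noteq> x0 \<Longrightarrow> r (\<sigma> (\<tau> y)) = Suc (r y)"
    and rank_max: "y \<in> X \<Longrightarrow> z \<in> X \<Longrightarrow> \<sigma> (\<tau> y) = x0 \<Longrightarrow> r z \<le> r y"
begin

text \<open>
  \<open>\<sigma> \<circ> \<tau>\<close> shifts half-open arcs of its own cyclic order by one step. The arc ends at an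
  element \<open>z\<close>, so it does not reach over the base point.
\<close>

lemma arc_shift:
  assumes "y \<in> X" "z \<in> X"
  shows "i < r (\<sigma> (\<tau> y)) \<and> r (\<sigma> (\<tau> y)) \<le> r z \<longleftrightarrow> i \<le> r y \<and> r y < r z"
proof (cases "\<sigma> (\<tau> y) = x0")
  case True
  then show ?thesis
    using rank_max[OF assms] base by auto
next
  case False
  then show ?thesis
    using rank_Suc[OF assms(1)] by auto
qed

lemma rank_eq: "y \<in> X \<Longrightarrow> z \<in> X \<Longrightarrow> r y = r z \<longleftrightarrow> y = z"
  using rank_inj by (meson inj_onD)

text \<open>
  The transposition of \<open>x\<close> and \<open>z\<close> lets the arc from \<open>x\<close> (excluded) to \<open>z\<close> return into itself, and it
  is not disturbed by \<open>\<tau> x\<close> and \<open>\<tau> z\<close> if these lie outside.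
\<close>

lemma single_switch:
  assumes x: "x \<in> X" and z: "z \<in> X" and P: "P x \<noteq> P z" and T: "T x \<noteq> T z" and less: "r x < r z"
    and out: "\<not> (r x < r (\<tau> x) \<and> r (\<tau> x) < r z)" "\<not> (r x < r (\<tau> z) \<and> r (\<tau> z) < r z)"
  shows "splits (\<tau> \<circ> switch x z) {m. r x < r m \<and> r m \<le> r z}"
  unfolding splits_def
proof (intro conjI ballI)
  fix m assume m: "m \<in> X"
  have sw: "switch x z m \<in> X"
    using switchable_switch[OF x z P T] m by (simp add: switchable_def)
  have d: "x \<noteq> \<tau> x" "z \<noteq> \<tau> z" "x \<noteq> \<tau> z" "z \<noteq> \<tau> x"
    using x z P T opp_opp opp_sign opp_kind by metis+
  have rd: "r x \<noteq> r (\<tau> x)" "r z \<noteq> r (\<tau> z)" "r x \<noteq> r (\<tau> z)" "r z \<noteq> r (\<tau> x)"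
    using d x z by (simp_all add: rank_eq opp_in)
  have "\<sigma> (\<tau> (switch x z m)) \<in> {m. r x < r m \<and> r m \<le> r z} \<longleftrightarrow>
      r x \<le> r (switch x z m) \<and> r (switch x z m) < r z"
    using arc_shift[OF sw z] by simp
  also have "\<dots> \<longleftrightarrow> r x < r m \<and> r m \<le> r z"
  proof (cases "m \<in> {x, z, \<tau> x, \<tau> z}")
    case True
    moreover have "switch x z x = z" "switch x z z = x"
        "switch x z (\<tau> x) = \<tau> z" "switch x z (\<tau> z) = \<tau> x"
      using d by (auto simp: switch_def)
    moreover have "r (\<tau> x) < r x \<or> r z < r (\<tau> x)" "r (\<tau> z) < r x \<or> r z < r (\<tau> z)"
      using out rd by linarith+
    ultimately show ?thesis
      using less by auto
  next
    case False
    then show ?thesis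
      using rank_eq[OF m x] rank_eq[OF m z] by (auto simp: switch_def)
  qed
  finally show "\<sigma> ((\<tau> \<circ> switch x z) m) \<in> {m. r x < r m \<and> r m \<le> r z} \<longleftrightarrow>
      m \<in> {m. r x < r m \<and> r m \<le> r z}"
    by simp
next
  show "\<exists>m\<in>X. m \<in> {m. r x < r m \<and> r m \<le> r z}" using z less by blast
  show "\<exists>m\<in>X. m \<notin> {m. r x < r m \<and> r m \<le> r z}" using x by blast
qed

text \<open>
  If no chord crosses the chord of \<open>x\<close> in the order of \<open>\<sigma> \<circ> \<tau>\<close>, then \<open>\<tau>\<close> maps the arc between its ends
  to itself, and therefore \<open>\<sigma> = (\<sigma> \<circ> \<tau>) \<circ> \<tau>\<close> preserves the arc from \<open>x\<close> (excluded) to \<open>\<tau> x\<close>. But \<open>\<sigma>\<close> is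
  transitive.
\<close>

lemma crossed:
  assumes x: "x \<in> X" and less: "r x < r (\<tau> x)"
  obtains u where "u \<in> X" "r x < r u" "r u < r (\<tau> x)" "r (\<tau> u) < r x \<or> r (\<tau> x) < r (\<tau> u)"
proof (rule ccontr)
  assume "\<not> thesis"
  then have none: "r x \<le> r (\<tau> u) \<and> r (\<tau> u) \<le> r (\<tau> x)"
    if "u \<in> X" "r x < r u" "r u < r (\<tau> x)" for u
    using that \<open>\<And>u. u \<in> X \<Longrightarrow> r x < r u \<Longrightarrow> r u < r (\<tau> x) \<Longrightarrow>
      r (\<tau> u) < r x \<or> r (\<tau> x) < r (\<tau> u) \<Longrightarrow> thesis\<close> by (meson not_le)
  have strict: "r x < r (\<tau> u) \<and> r (\<tau> u) < r (\<tau> x)"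
    if u: "u \<in> X" "r x < r u" "r u < r (\<tau> x)" for u
  proof -
    have "\<tau> u \<noteq> x" "\<tau> u \<noteq> \<tau> x"
      using u x opp_opp by (metis less_irrefl)+
    then show ?thesis
      using none[OF u] rank_eq[OF opp_in[OF u(1)] x] rank_eq[OF opp_in[OF u(1)] opp_in[OF x]]
      by linarith
  qed
  have "\<sigma> u \<in> {m. r x < r m \<and> r m \<le> r (\<tau> x)} \<longleftrightarrow> u \<in> {m. r x < r m \<and> r m \<le> r (\<tau> x)}"
    if u: "u \<in> X" for u
  proof -
    have "\<sigma> u \<in> {m. r x < r m \<and> r m \<le> r (\<tau> x)} \<longleftrightarrow> r x \<le> r (\<tau> u) \<and> r (\<tau> u) < r (\<tau> x)"
      using arc_shift[OF opp_in[OF u] opp_in[OF x], of "r x"] opp_opp[OF u] by simp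
    also have "\<dots> \<longleftrightarrow> r x < r u \<and> r u \<le> r (\<tau> x)"
    proof
      assume l: "r x \<le> r (\<tau> u) \<and> r (\<tau> u) < r (\<tau> x)"
      show "r x < r u \<and> r u \<le> r (\<tau> x)"
      proof (cases "\<tau> u = x")
        case True
        then have "u = \<tau> x"
          using opp_opp[OF u] by simp
        then show ?thesis using less by simp
      next
        case False
        then have "r x < r (\<tau> u)"
          using l rank_eq[OF opp_in[OF u] x] by linarith
        then show ?thesis
          using strict[of "\<tau> u"] l opp_in[OF u] opp_opp[OF u] by simp
      qed
    next
      assume l: "r x < r u \<and> r u \<le> r (\<tau> x)"
      show "r x \<le> r (\<tau> u) \<and> r (\<tau> u) < r (\<tau> x)"
      proof (cases "u = \<tau> x")
        case True
        then show ?thesis using less opp_opp[OF x] by simp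
      next
        case False
        then have "r u < r (\<tau> x)"
          using l rank_eq[OF u opp_in[OF x]] by linarith
        then show ?thesis
          using strict[of u] l u by simp
      qed
    qed
    finally show ?thesis by simp
  qed
  then have "X \<subseteq> {m. r x < r m \<and> r m \<le> r (\<tau> x)}"
    by (rule one_circle[OF _ opp_in[OF x]]) (use less in auto)
  then show False
    using x by blast
qed

text \<open>
  If no single switch splits, the ends of two crossing chords of one sign, one of which begins at
  \<open>x0\<close>, and of two crossing chords of the other sign, one of which ends at \<open>y0\<close>, can only occur in the
  order \<open>x, u, \<tau> x, \<tau> u, w, z, \<tau> w, \<tau> z\<close>, where \<open>x, u\<close> are ends of one kind and \<open>w, z\<close> of the other. Exchanging
  \<open>x\<close> with \<open>z\<close>, \<open>u\<close> with \<open>w\<close>, \<open>\<tau> x\<close> with \<open>\<tau> z\<close> and \<open>\<tau> u\<close> with \<open>\<tau> w\<close> swaps the arcs from \<open>x\<close> to \<open>u\<close> and from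
  \<open>w\<close> to \<open>z\<close>: leaving the first arc at \<open>u\<close> leads on behind \<open>w\<close>, and leaving the second one at \<open>z\<close> leads on
  behind \<open>x\<close>. So their union is invariant.
\<close>

lemma some_switch_splits: "\<exists>\<pi> J. switchable \<pi> \<and> splits (\<tau> \<circ> \<pi>) J"
proof (rule ccontr)
  assume no: "\<not> ?thesis"
  \<comment> \<open>\<open>B\<close>: the two transpositions of every switch cross.\<close>
  have B: "(r x < r (\<tau> x) \<and> r (\<tau> x) < r z) \<or> (r x < r (\<tau> z) \<and> r (\<tau> z) < r z)"
    if "x \<in> X" "z \<in> X" "P x \<noteq> P z" "T x \<noteq> T z" "r x < r z" for x z
    using no single_switch[OF that] switchable_switch[OF that(1-4)] by blast
  \<comment> \<open>\<open>NC\<close>: chords of opposite signs do not cross.\<close>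
  have NC: False
    if "x \<in> X" "u \<in> X" "P x \<noteq> P u" "r x < r u" "r u < r (\<tau> x)" "r (\<tau> x) < r (\<tau> u)" for x u
  proof (cases "T u = T x")
    case True
    then show ?thesis
      using B[of u "\<tau> x"] that opp_in opp_opp opp_sign opp_kind by (metis less_asym less_trans)
  next
    case False
    then show ?thesis
      using B[of x u] that by (metis less_asym less_trans)
  qed
  have pos: "0 < r m" if "m \<in> X" "m \<noteq> x0" for m
    using that rank_eq[OF that(1) base(1)] base(2) by simp
  have top: "r m < r y0" if "m \<in> X" "m \<noteq> y0" for m
    using that rank_max[OF final(1) that(1) final(2)] rank_eq[OF that(1) final(1)] by simp
  define x where "x = x0"
  have x: "x \<in> X" "r x = 0" "\<tau> x \<in> X" "x \<noteq> \<tau> x" "y0 \<noteq> x" "y0 \<noteq> \<tau> x" "\<tau> y0 \<noteq> \<tau> x" "\<tau> y0 \<noteq> x"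
    using base final opp_in opp_sign opp_kind opp_opp unfolding x_def by metis+
  have y: "\<tau> y0 \<in> X" "y0 \<noteq> \<tau> y0"
    using final(1) opp_in opp_kind by metis+
  \<comment> \<open>Otherwise the switch of \<open>\<tau> x0\<close> and \<open>\<tau> y0\<close> splits, since \<open>x0\<close> and \<open>y0\<close> are extreme.\<close>
  have kind: "T y0 = T x0"
  proof (rule ccontr)
    assume ne: "T y0 \<noteq> T x0"
    have "r (\<tau> x) \<noteq> r (\<tau> y0)"
      using rank_eq x y by simp
    moreover have "\<not> r (\<tau> x) < r (\<tau> y0)"
      using B[of "\<tau> x" "\<tau> y0"] x y ne final(1,3) opp_opp[OF x(1)] opp_opp[OF final(1)] opp_sign opp_kind
        top[OF y(1)] by (metis x_def less_asym not_less0)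
    moreover have "\<not> r (\<tau> y0) < r (\<tau> x)"
      using B[of "\<tau> y0" "\<tau> x"] x y ne final(1,3) opp_opp[OF x(1)] opp_opp[OF final(1)] opp_sign opp_kind
        top[OF x(3)] by (metis x_def less_asym not_less0)
    ultimately show False by simp
  qed
  define z where "z = \<tau> y0"
  have z: "z \<in> X" "\<tau> z = y0" "P z \<noteq> P x" "T z \<noteq> T x"
    using y final opp_opp opp_sign opp_kind kind unfolding z_def x_def by metis+
  have xz: "r x < r z" and z_top: "r z < r (\<tau> z)"
    using pos[of z] top[of z] x y z by (auto simp: x_def z_def)
  have txz: "r x < r (\<tau> x)" "r (\<tau> x) < r z"
    using B[OF x(1) z(1)] z xz z_top by auto
  \<comment> \<open>A chord crossing that of \<open>x\<close>; it has the same sign, and its ends fit in before \<open>z\<close>.\<close>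
  obtain u where u: "u \<in> X" "r x < r u" "r u < r (\<tau> x)" "r (\<tau> x) < r (\<tau> u)"
    using crossed[OF x(1) txz(1)] x(2) by auto
  have Pu: "P u = P x"
    using NC[OF x(1) u(1)] u by auto
  have tu: "\<tau> u \<in> X" "r (\<tau> u) \<noteq> r z" "r (\<tau> u) \<noteq> r (\<tau> z)" "r (\<tau> u) < r (\<tau> z)"
  proof -
    show 1: "\<tau> u \<in> X" using u opp_in by simp
    have "\<tau> u \<noteq> z" "\<tau> u \<noteq> \<tau> z"
      using Pu z(1,3) u(1) opp_sign by metis+
    then show "r (\<tau> u) \<noteq> r z" "r (\<tau> u) \<noteq> r (\<tau> z)" "r (\<tau> u) < r (\<tau> z)"
      using rank_eq[OF 1 z(1)] rank_eq[OF 1 opp_in[OF z(1)]] top[OF 1] z(2) by auto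
  qed
  have tuz: "r (\<tau> u) < r z"
  proof (rule ccontr)
    assume "\<not> r (\<tau> u) < r z"
    then show False
      using NC[OF u(1) z(1)] tu u txz Pu z(3) by auto
  qed
  have Tu: "T u = T x"
  proof (rule ccontr)
    assume "T u \<noteq> T x"
    then have "T (\<tau> u) \<noteq> T z"
      using z u opp_kind by metis
    then show False
      using B[OF tu(1) z(1) _ _ tuz] opp_opp[OF u(1)] opp_sign[OF u(1)] Pu z(3) u tu z_top by auto
  qed
  \<comment> \<open>A chord crossing that of \<open>z\<close>; its first end \<open>w\<close> is squeezed in between \<open>\<tau> u\<close> and \<open>z\<close>.\<close>
  obtain v where v: "v \<in> X" "r z < r v" "r v < r (\<tau> z)" "r (\<tau> v) < r z \<or> r (\<tau> z) < r (\<tau> v)"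
    using crossed[OF z(1) z_top] by blast
  define w where "w = \<tau> v"
  have w: "w \<in> X" "\<tau> w = v"
    using v opp_in opp_opp unfolding w_def by auto
  have wz: "r w < r z"
    using v(4) rank_max[OF final(1) w(1) final(2)] z(2) unfolding w_def by auto
  have Pw: "P w = P z"
    using NC[OF w(1) z(1)] wz w v by auto
  have w_ne: "w \<noteq> x" "w \<noteq> \<tau> x" "w \<noteq> u" "w \<noteq> \<tau> u"
    using Pw Pu z(3) x u opp_sign by metis+
  have uw: "r (\<tau> u) < r w"
  proof (rule ccontr)
    assume "\<not> r (\<tau> u) < r w"
    then have l: "r w < r (\<tau> u)"
      using rank_eq[OF w(1) tu(1)] w_ne by simp
    have "r w \<noteq> r (\<tau> x)" "0 < r w"
      using rank_eq[OF w(1) x(3)] w_ne pos[OF w(1)] by (auto simp: x_def)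
    then consider "0 < r w" "r w < r (\<tau> x)" | "r (\<tau> x) < r w"
      by linarith
    then show False
    proof cases
      case 1
      then show False
        using NC[OF x(1) w(1)] w v x txz Pw z(3) by auto
    next
      case 2
      then show False
        using NC[OF u(1) w(1)] w v u l Pw Pu z(3) tuz by auto
    qed
  qed
  have Tw: "T w = T z"
  proof (rule ccontr)
    assume "T w \<noteq> T z"
    then have "T (\<tau> x) \<noteq> T w"
      using z x opp_kind by metis
    then show False
      using B[OF x(3) w(1)] opp_opp[OF x(1)] opp_sign[OF x(1)] Pw z(3) w v u uw wz x(2) by auto
  qed
  have sw1: "switchable (switch x z)"
    by (rule switchable_switch) (use x z in auto)
  have sw2: "switchable (switch u w)"
    by (rule switchable_switch) (use u w Pw Pu Tw Tu z in auto)
  have order: "r x < r u" "r u < r (\<tau> x)" "r (\<tau> x) < r (\<tau> u)" "r (\<tau> u) < r w" "r w < r z"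
      "r z < r (\<tau> w)" "r (\<tau> w) < r (\<tau> z)"
    using u uw wz v w by auto
  have s1: "switch x z x = z" "switch x z z = x" "switch x z (\<tau> x) = \<tau> z" "switch x z (\<tau> z) = \<tau> x"
      "switch x z u = u" "switch x z w = w" "switch x z (\<tau> u) = \<tau> u" "switch x z (\<tau> w) = \<tau> w"
    and s2: "switch u w u = w" "switch u w w = u" "switch u w (\<tau> u) = \<tau> w" "switch u w (\<tau> w) = \<tau> u"
      "switch u w x = x" "switch u w z = z" "switch u w (\<tau> x) = \<tau> x" "switch u w (\<tau> z) = \<tau> z"
    using order by (auto simp: switch_def)
  have fixed: "switch x z m = m" "switch u w m = m" 
    if "m \<notin> {x, z, \<tau> x, \<tau> z, u, w, \<tau> u, \<tau> w}" for m
    using that by (auto simp: switch_def)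
  define \<pi> where "\<pi> = switch x z \<circ> switch u w"
  have pi: "\<pi> x = z" "\<pi> z = x" "\<pi> (\<tau> x) = \<tau> z" "\<pi> (\<tau> z) = \<tau> x"
      "\<pi> u = w" "\<pi> w = u" "\<pi> (\<tau> u) = \<tau> w" "\<pi> (\<tau> w) = \<tau> u"
    and pi_fixed: "\<And>m. m \<notin> {x, z, \<tau> x, \<tau> z, u, w, \<tau> u, \<tau> w} \<Longrightarrow> \<pi> m = m"
    using s1 s2 fixed by (auto simp: \<pi>_def)
  have sw: "switchable \<pi>"
    unfolding \<pi>_def
  proof (rule switchable_comp[OF sw1 sw2])
    show "switch x z m = m \<or> switch u w m = m" for m
      using s1 s2 fixed by (cases "m \<in> {x, z, \<tau> x, \<tau> z, u, w, \<tau> u, \<tau> w}") auto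
  qed
  define J where "J = {m. r x < r m \<and> r m \<le> r u \<or> r w < r m \<and> r m \<le> r z}"
  have "splits (\<tau> \<circ> \<pi>) J"
    unfolding splits_def
  proof (intro conjI ballI)
    fix m assume m: "m \<in> X"
    have pm: "\<pi> m \<in> X" using sw m by (simp add: switchable_def)
    have "\<sigma> ((\<tau> \<circ> \<pi>) m) \<in> J \<longleftrightarrow>
        r x \<le> r (\<pi> m) \<and> r (\<pi> m) < r u \<or> r w \<le> r (\<pi> m) \<and> r (\<pi> m) < r z"
      using arc_shift[OF pm u(1), of "r x"] arc_shift[OF pm z(1), of "r w"] by (simp add: J_def)
    also have "\<dots> \<longleftrightarrow> m \<in> J"
    proof (cases "m \<in> {x, z, \<tau> x, \<tau> z, u, w, \<tau> u, \<tau> w}")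
      case True
      then show ?thesis
        using pi order by (auto simp: J_def)
    next
      case False
      then have "r m \<noteq> r x" "r m \<noteq> r u" "r m \<noteq> r w" "r m \<noteq> r z"
        using rank_eq[OF m x(1)] rank_eq[OF m u(1)] rank_eq[OF m w(1)] rank_eq[OF m z(1)]
        by auto
      then show ?thesis
        using pi_fixed[OF False] by (auto simp: J_def)
    qed
    finally show "\<sigma> ((\<tau> \<circ> \<pi>) m) \<in> J \<longleftrightarrow> m \<in> J" .
  next
    show "\<exists>m\<in>X. m \<in> J" using u by (auto simp: J_def)
    show "\<exists>m\<in>X. m \<notin> J"
      by (rule bexI[of _ x]) (use x order in \<open>auto simp: J_def\<close>)
  qed
  then show False
    using no sw by blast
qed

end

context chord_circle
begin

text \<open>
  If \<open>\<sigma> \<circ> \<tau>\<close> is a single cycle, the sign cannot be constant along it, which provides the base point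
  demanded by \<open>ranked_chord_circle\<close>.
\<close>

lemma splitting_rematching:
  assumes "p \<in> X" "P p" "q \<in> X" "\<not> P q"
  shows "\<exists>\<mu> J. rematching X \<tau> P T \<mu> \<and> splits \<mu> J"
proof (cases "\<exists>J. splits \<tau> J")
  case True
  moreover have "rematching X \<tau> P T \<tau>"
    using opp_in opp_opp by (simp add: rematching_def)
  ultimately show ?thesis by blast
next
  case False
  have trans: "X \<subseteq> J" if "\<And>y. y \<in> X \<Longrightarrow> (\<sigma> \<circ> \<tau>) y \<in> J \<longleftrightarrow> y \<in> J" "x \<in> X" "x \<in> J" for x J
  proof (rule ccontr)
    assume "\<not> X \<subseteq> J"
    then have "splits \<tau> J"
      unfolding splits_def using that(2,3) that(1)[unfolded comp_apply] by blast
    then show False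
      using False by blast
  qed
  obtain y where y: "y \<in> X" "P (\<sigma> (\<tau> y)) \<noteq> P y"
    using trans[of "{m. P m}" p] assms by auto
  define x where "x = \<sigma> (\<tau> y)"
  have x: "x \<in> X"
    using y succ_in opp_in by (simp add: x_def)
  have "(\<sigma> \<circ> \<tau>) y \<in> X" if "y \<in> X" for y
    using that succ_in opp_in by simp
  from cyclic_rank[OF fin this smoothing_inj x trans[OF _ x]]
  obtain r :: "'a \<Rightarrow> nat" where r: "inj_on r X" "r x = 0"
    "\<And>y. y \<in> X \<Longrightarrow> (\<sigma> \<circ> \<tau>) y \<noteq> x \<Longrightarrow> r ((\<sigma> \<circ> \<tau>) y) = Suc (r y)"
    "\<And>y z. y \<in> X \<Longrightarrow> z \<in> X \<Longrightarrow> (\<sigma> \<circ> \<tau>) y = x \<Longrightarrow> r z \<le> r y"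
    by blast
  interpret ranked_chord_circle X \<sigma> \<tau> P T r x y
    using r x y by unfold_locales (auto simp: x_def)
  show ?thesis
    using some_switch_splits rematching_switchable by blast
qed

end

section \<open>Saddles along a matching\<close>

text \<open>
  The letters of the words in this section are blocks of endpoints. Singleton blocks are the endpoints
  still to be treated; \<open>[\<mu> p, p]\<close> is a matched pair that has already been made adjacent and is no longer
  cut. \<open>coloured c \<mu> g w h\<close> says that colour \<open>g\<close> turns into colour \<open>h\<close> when \<open>w\<close> is traversed: an untreated
  endpoint \<open>p\<close> is entered with colour \<open>c p\<close> and left with colour \<open>c (\<mu> p)\<close>, while a treated pair is
  transparent, because it will be deleted.
\<close>

primrec coloured :: "('a \<Rightarrow> 'c) \<Rightarrow> ('a \<Rightarrow> 'a) \<Rightarrow> 'c \<Rightarrow> 'a list list \<Rightarrow> 'c \<Rightarrow> bool" where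
  "coloured c \<mu> g [] h \<longleftrightarrow> g = h"
| "coloured c \<mu> g (b # w) h \<longleftrightarrow>
     (case b of [p] \<Rightarrow> g = c p \<and> coloured c \<mu> (c (\<mu> p)) w h | _ \<Rightarrow> coloured c \<mu> g w h)"

primrec gap_colours :: "('a \<Rightarrow> 'c) \<Rightarrow> ('a \<Rightarrow> 'a) \<Rightarrow> 'c \<Rightarrow> 'a list list \<Rightarrow> 'c set" where
  "gap_colours c \<mu> g [] = {g}"
| "gap_colours c \<mu> g (b # w) = insert g
     (case b of [p] \<Rightarrow> gap_colours c \<mu> (c (\<mu> p)) w | _ \<Rightarrow> gap_colours c \<mu> g w)"

lemma coloured_append:
  "coloured c \<mu> g (x @ y) h \<longleftrightarrow> (\<exists>k. coloured c \<mu> g x k \<and> coloured c \<mu> k y h)"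
  by (induction x arbitrary: g) (auto split: list.split)

lemma gap_colours_start: "g \<in> gap_colours c \<mu> g w"
  by (cases w) auto

lemma gap_colours_append:
  "coloured c \<mu> g x k \<Longrightarrow> gap_colours c \<mu> g (x @ y) = gap_colours c \<mu> g x \<union> gap_colours c \<mu> k y"
proof (induction x arbitrary: g)
  case Nil
  then show ?case using gap_colours_start[of g c \<mu> y] by auto
qed (auto split: list.splits)

lemma gap_colours_blocks:
  "(\<And>b. b \<in> set w \<Longrightarrow> length b \<noteq> 1) \<Longrightarrow> gap_colours c \<mu> g w = {g}"
proof (induction w)
  case (Cons b w)
  have "length b \<noteq> 1" "gap_colours c \<mu> g w = {g}"
    using Cons by auto
  then show ?case
    by (cases b) (auto split: list.split)
qed simp

text \<open>
  A circle is cut open at an arc of the given colour; a circle without untreated endpoints still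
  remembers its colour in this way.
\<close>

type_synonym ('a, 'c) coloured_circle = "'c \<times> 'a list list"

definition proper :: "('a \<Rightarrow> 'c) \<Rightarrow> ('a \<Rightarrow> 'a) \<Rightarrow> ('a, 'c) coloured_circle list \<Rightarrow> bool" where
  "proper c \<mu> W \<longleftrightarrow> (\<forall>(g, w)\<in>set W. coloured c \<mu> g w g)"

definition colours :: "('a \<Rightarrow> 'c) \<Rightarrow> ('a \<Rightarrow> 'a) \<Rightarrow> ('a, 'c) coloured_circle list \<Rightarrow> 'c set" where
  "colours c \<mu> W = (\<Union>(g, w)\<in>set W. gap_colours c \<mu> g w)"

definition blocks :: "('a, 'c) coloured_circle list \<Rightarrow> 'a list list" where
  "blocks W = concat (map snd W)"

definition circles :: "('a, 'c) coloured_circle list \<Rightarrow> 'a list list" where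
  "circles W = map (concat \<circ> snd) W"

lemma concat_circles: "concat (circles W) = concat (blocks W)"
  by (induction W) (auto simp: circles_def blocks_def)

text \<open>
  The saddle cuts before \<open>p\<close> and after \<open>q\<close> and glues so that \<open>q\<close> is followed by \<open>p\<close>. Since \<open>p\<close> and \<open>q\<close> are
  matched, the arcs before \<open>p\<close> and after \<open>q\<close> have the same colour \<open>c p\<close>, and the arcs after \<open>p\<close> and
  before \<open>q\<close> have the same colour \<open>c q\<close>. Hence the colouring passes to the new circles, and no colour
  is lost when the pair becomes transparent.
\<close>

lemma surgery_pair:
  assumes proper: "proper c \<mu> W" and p: "[p] \<in> set (blocks W)" and q: "[q] \<in> set (blocks W)"
    and ne: "p \<noteq> q" and mu: "\<mu> p = q" "\<mu> q = p"
  shows "\<exists>W'. proper c \<mu> W' \<and> surgery 1 (circles W) (circles W') \<and> colours c \<mu> W \<subseteq> colours c \<mu> W' \<and>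
    mset (blocks W') + {#[p], [q]#} = mset (blocks W) + {#[q, p]#}"
proof -
  obtain g w where gw: "(g, w) \<in> set W" "[p] \<in> set w"
    using p by (auto simp: blocks_def)
  obtain A B where W: "W = A @ (g, w) # B"
    using gw by (meson split_list)
  obtain x y where w: "w = x @ [p] # y"
    using gw by (meson split_list)
  define R where "R = A @ B"
  have "coloured c \<mu> g w g" and R: "proper c \<mu> R"
    using proper W by (auto simp: proper_def R_def)
  then have x: "coloured c \<mu> g x (c p)" and y: "coloured c \<mu> (c q) y g"
    by (auto simp: w coloured_append mu)
  \<comment> \<open>\<open>b\<close> is what follows \<open>p\<close> on its circle until the circle closes up.\<close>
  define b where "b = y @ x"
  have b: "coloured c \<mu> (c q) b (c p)"
    using x y by (auto simp: b_def coloured_append)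
  have gb: "gap_colours c \<mu> g w \<subseteq> insert (c p) (gap_colours c \<mu> (c q) b)"
    using gap_colours_append[OF x, of "[p] # y"] gap_colours_append[OF y, of x]
      gap_colours_start[of g c \<mu> x] by (auto simp: w b_def mu)
  have W_R: "mset (blocks W) = mset (blocks R) + mset b + {#[p]#}"
      "colours c \<mu> W = colours c \<mu> R \<union> gap_colours c \<mu> g w"
    by (auto simp: W R_def w b_def blocks_def colours_def)
  have to_p: "surgery 0 (circles W) (circles R @ [[p] @ concat b])"
  proof -
    have "surgery 0 (circles W) (circles R @ [concat x @ [p] @ concat y])"
      by (rule surgery.permute[OF surgery.refl]) (simp add: circles_def W R_def w)
    from surgery.rotate[OF this] show ?thesis
      by (simp add: b_def)
  qed
  show ?thesis
  proof (cases "[q] \<in> set b")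
    case True
    \<comment> \<open>\<open>p\<close> and \<open>q\<close> lie on the same circle, and the saddle splits off the part behind \<open>q\<close>.\<close>
    then obtain d e where bq: "b = d @ [q] # e"
      by (meson split_list)
    have d: "coloured c \<mu> (c q) d (c q)" and e: "coloured c \<mu> (c p) e (c p)"
      using b by (auto simp: bq coloured_append mu)
    define W' where "W' = R @ [(c q, [q, p] # d), (c p, e)]"
    have "surgery 0 (circles W) (circles R @ [([p] @ concat d @ [q]) @ concat e])"
      using to_p by (simp add: bq)
    from surgery.permute[OF surgery.split[OF this],
        of "(circles R @ [concat e]) @ [([p] @ concat d) @ [q]]"]
    have "surgery 1 (circles W) ((circles R @ [concat e]) @ [([p] @ concat d) @ [q]])"
      by simp
    from surgery.permute[OF surgery.rotate[OF this], of "circles W'"]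
    have "surgery 1 (circles W) (circles W')"
      by (simp add: W'_def circles_def)
    moreover have "proper c \<mu> W'"
      using R d e by (auto simp: proper_def W'_def)
    moreover have "colours c \<mu> W \<subseteq> colours c \<mu> W'"
    proof -
      have "gap_colours c \<mu> (c q) b \<subseteq> gap_colours c \<mu> (c q) d \<union> gap_colours c \<mu> (c p) e"
        using gap_colours_append[OF d, of "[q] # e"] gap_colours_start[of "c q" c \<mu> d]
        by (auto simp: bq mu)
      then show ?thesis
        using W_R(2) gb gap_colours_start[of "c p" c \<mu> e] by (auto simp: W'_def colours_def)
    qed
    moreover have "mset (blocks W') + {#[p], [q]#} = mset (blocks W) + {#[q, p]#}"
      unfolding W_R(1) by (simp add: W'_def blocks_def bq)
    ultimately show ?thesis by blast
  next
    case False
    then have "[q] \<in> set (blocks R)"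
      using q ne by (auto simp: W R_def blocks_def w b_def)
    then obtain g' w' where gw': "(g', w') \<in> set R" "[q] \<in> set w'"
      by (auto simp: blocks_def)
    obtain A' B' where R': "R = A' @ (g', w') # B'"
      using gw' by (meson split_list)
    obtain x' y' where w': "w' = x' @ [q] # y'"
      using gw' by (meson split_list)
    define S where "S = A' @ B'"
    have "coloured c \<mu> g' w' g'" and S: "proper c \<mu> S"
      using R R' by (auto simp: proper_def S_def)
    then have x': "coloured c \<mu> g' x' (c q)" and y': "coloured c \<mu> (c p) y' g'"
      by (auto simp: w' coloured_append mu)
    \<comment> \<open>Here \<open>q\<close> lies on another circle, on which \<open>e\<close> follows \<open>q\<close>, and the saddle merges the two circles.\<close>
    define e where "e = y' @ x'"
    have e: "coloured c \<mu> (c p) e (c q)"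
      using x' y' by (auto simp: e_def coloured_append)
    have ge: "gap_colours c \<mu> g' w' \<subseteq> insert (c q) (gap_colours c \<mu> (c p) e)"
      using gap_colours_append[OF x', of "[q] # y'"] gap_colours_append[OF y', of x']
        gap_colours_start[of g' c \<mu> x'] by (auto simp: w' e_def mu)
    have R_S: "mset (blocks R) = mset (blocks S) + mset e + {#[q]#}"
        "colours c \<mu> R = colours c \<mu> S \<union> gap_colours c \<mu> g' w'"
      by (auto simp: R' S_def w' e_def blocks_def colours_def)
    define W' where "W' = S @ [(c q, [q, p] # b @ e)]"
    from surgery.permute[OF to_p, of "(circles S @ [[p] @ concat b]) @ [(concat x' @ [q]) @ concat y']"]
    have "surgery 0 (circles W) ((circles S @ [[p] @ concat b]) @ [(concat x' @ [q]) @ concat y'])"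
      by (simp add: circles_def R' S_def w')
    from surgery.permute[OF surgery.rotate[OF this],
        of "circles S @ [concat e @ [q], [p] @ concat b]"]
    have "surgery 0 (circles W) (circles S @ [concat e @ [q], [p] @ concat b])"
      by (simp add: e_def)
    from surgery.merge[OF this]
    have "surgery 1 (circles W) (circles S @ [concat e @ ([q] @ [p] @ concat b)])"
      by simp
    from surgery.rotate[OF this] have "surgery 1 (circles W) (circles W')"
      by (simp add: W'_def circles_def)
    moreover have "proper c \<mu> W'"
      using S b e by (auto simp: proper_def W'_def coloured_append)
    moreover have "colours c \<mu> W \<subseteq> colours c \<mu> W'"
      using W_R(2) R_S(2) gb ge gap_colours_append[OF b, of e] gap_colours_start[of "c p" c \<mu> e]
      by (auto simp: W'_def colours_def)
    moreover have "mset (blocks W') + {#[p], [q]#} = mset (blocks W) + {#[q, p]#}"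
      unfolding W_R(1) R_S(1) by (simp add: W'_def blocks_def)
    ultimately show ?thesis by blast
  qed
qed

lemma surgery_matching:
  assumes "card {x. [x] \<in> set (blocks W)} = 2 * n" "proper c \<mu> W" "distinct (concat (blocks W))"
    "\<And>x. [x] \<in> set (blocks W) \<Longrightarrow> [\<mu> x] \<in> set (blocks W) \<and> \<mu> (\<mu> x) = x \<and> \<mu> x \<noteq> x"
    "\<And>b. b \<in> set (blocks W) \<Longrightarrow> length b = 1 \<or> (\<exists>x. b = [\<mu> x, x])"
  shows "\<exists>W'. proper c \<mu> W' \<and> surgery n (circles W) (circles W') \<and> colours c \<mu> W \<subseteq> colours c \<mu> W' \<and>
    (\<forall>b\<in>set (blocks W'). \<exists>x. b = [\<mu> x, x])"
  using assms
proof (induction n arbitrary: W)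
  case 0
  have "finite {x. [x] \<in> set (blocks W)}"
    using finite_vimageI[of "set (blocks W)" "\<lambda>x. [x]"] by (simp add: vimage_def inj_def)
  then have "\<not> [x] \<in> set (blocks W)" for x
    using 0(1) by auto
  then have "\<exists>x. b = [\<mu> x, x]" if "b \<in> set (blocks W)" for b
    using 0(5)[OF that] that by (cases b) auto
  then show ?case
    using 0(2) surgery.refl by blast
next
  case (Suc n)
  have fin: "finite {x. [x] \<in> set (blocks W)}"
    using finite_vimageI[of "set (blocks W)" "\<lambda>x. [x]"] by (simp add: vimage_def inj_def)
  obtain p where p: "[p] \<in> set (blocks W)"
    using Suc.prems(1) by fastforce
  define q where "q = \<mu> p"
  have q: "[q] \<in> set (blocks W)" "p \<noteq> q" "\<mu> p = q" "\<mu> q = p"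
    using Suc.prems(4)[OF p] by (auto simp: q_def)
  obtain V where V: "proper c \<mu> V" "surgery 1 (circles W) (circles V)"
      "colours c \<mu> W \<subseteq> colours c \<mu> V"
      "mset (blocks V) + {#[p], [q]#} = mset (blocks W) + {#[q, p]#}"
    using surgery_pair[OF Suc.prems(2) p q] by blast
  have "[] \<notin> set (blocks W)"
    using Suc.prems(5) by fastforce
  then have "distinct (blocks W)"
    using Suc.prems(3) by (simp add: distinct_concat_iff removeAll_id)
  then have cnt: "count (mset (blocks W)) b = of_bool (b \<in> set (blocks W))" for b
    by (simp add: distinct_count_atmost_1)
  have single: "[x] \<in> set (blocks V) \<longleftrightarrow> [x] \<in> set (blocks W) \<and> x \<noteq> p \<and> x \<noteq> q" for x
  proof -
    define m where "m = count (mset (blocks V)) [x]"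
    have "count {#[p], [q]#} [x] = of_bool (x = p \<or> x = q)"
      using q(2) by auto
    moreover have "m + count {#[p], [q]#} [x] = count (mset (blocks W) + {#[q, p]#}) [x]"
      unfolding m_def V(4)[symmetric] by (rule count_union[symmetric])
    ultimately have "m + of_bool (x = p \<or> x = q) = of_bool ([x] \<in> set (blocks W))"
      using cnt[of "[x]"] by simp
    moreover have "[x] \<in> set (blocks V) \<longleftrightarrow> m \<noteq> 0"
      by (simp add: m_def)
    moreover have "x = p \<or> x = q \<Longrightarrow> [x] \<in> set (blocks W)"
      using p q(1) by blast
    ultimately show ?thesis
      by (cases "x = p \<or> x = q") auto
  qed
  have "{x. [x] \<in> set (blocks W)} = insert p (insert q {x. [x] \<in> set (blocks V)})"
    using p q single by auto
  moreover have "finite {x. [x] \<in> set (blocks V)}"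
    using fin single by (auto elim!: finite_subset[rotated])
  ultimately have "card {x. [x] \<in> set (blocks V)} = 2 * n"
    using Suc.prems(1) q(2) single by (simp add: card_insert_if)
  moreover have "distinct (concat (blocks V))"
    using Suc.prems(3) surgery_mset[OF V(2)] mset_eq_imp_distinct_iff
    unfolding concat_circles by blast
  moreover have "[\<mu> x] \<in> set (blocks V) \<and> \<mu> (\<mu> x) = x \<and> \<mu> x \<noteq> x" if "[x] \<in> set (blocks V)" for x
    using that Suc.prems(4)[of x] q unfolding single by auto
  moreover have "length b = 1 \<or> (\<exists>x. b = [\<mu> x, x])" if "b \<in> set (blocks V)" for b
  proof -
    have "b \<in># mset (blocks W) + {#[q, p]#}"
      unfolding V(4)[symmetric] using that by simp
    then show ?thesis
      using Suc.prems(5)[of b] q by auto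
  qed
  ultimately obtain W' where "proper c \<mu> W'" "surgery n (circles V) (circles W')"
      "colours c \<mu> V \<subseteq> colours c \<mu> W'" "\<forall>b\<in>set (blocks W'). \<exists>x. b = [\<mu> x, x]"
    using Suc.IH[OF _ V(1)] by blast
  then show ?case
    using V(3) surgery_trans[OF _ V(2)] by fastforce
qed

lemma coloured_singletons:
  assumes "w \<noteq> []" "\<And>i. Suc i < length w \<Longrightarrow> c (w ! Suc i) = c (\<mu> (w ! i))"
  shows "coloured c \<mu> (c (hd w)) (map (\<lambda>x. [x]) w) (c (\<mu> (last w)))"
  using assms
proof (induction w)
  case (Cons x w)
  show ?case
  proof (cases w)
    case (Cons y v)
    have "c (w ! Suc i) = c (\<mu> (w ! i))" if "Suc i < length w" for i
      using Cons.prems(2)[of "Suc i"] that by simp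
    then have "coloured c \<mu> (c y) (map (\<lambda>x. [x]) w) (c (\<mu> (last w)))"
      using Cons.IH Cons by simp
    moreover have "c y = c (\<mu> x)"
      using Cons.prems(2)[of 0] Cons by simp
    ultimately show ?thesis
      using Cons by simp
  qed simp
qed simp

lemma gap_colours_singletons:
  "coloured c \<mu> g (map (\<lambda>x. [x]) w) h \<Longrightarrow> c ` set w \<subseteq> gap_colours c \<mu> g (map (\<lambda>x. [x]) w)"
  by (induction w arbitrary: g) auto

section \<open>Cancelling matched pairs\<close>

text \<open>
  The blocks \<open>bs\<close> are the arcs of a local move that inserts chords on empty arcs, performed
  backwards. Its template has the hole \<open>Inr i\<close> in the place of the block \<open>bs ! i\<close>.
\<close>

lemma descent_remove_blocks:
  assumes gauss: "gauss_diagram (map concat W)" and W: "distinct (concat W)"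
    and bs: "distinct bs" "set bs \<subseteq> set (concat W)"
    and move: "local_move (map (\<lambda>_. []) bs) bs"
    and closed: "\<And>e. e \<in> set (concat bs) \<Longrightarrow> opposite_end e \<in> set (concat bs)"
  defines "W' \<equiv> map (filter (\<lambda>b. b \<notin> set bs)) W"
  shows "gauss_diagram (map concat W') \<and> descent 0 0 (map concat W) (map concat W')"
proof -
  have cc: "concat (map concat V) = concat (concat V)" for V :: "endpoint list list list"
    by (induction V) auto
  have cW': "concat W' = filter (\<lambda>b. b \<notin> set bs) (concat W)"
    by (simp add: W'_def filter_concat)
  have g': "gauss_diagram (map concat W')"
  proof (rule gauss_diagram_subset[OF gauss])
    have d: "distinct (concat (concat W))"
      using gauss by (simp add: gauss_diagram_def cc)
    have filter: "distinct (concat (filter P L)) \<and> set (concat (filter P L)) \<subseteq> set (concat L)"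
      if "distinct (concat L)" for P and L :: "endpoint list list"
      using that by (induction L) auto
    show "distinct (concat (map concat W'))" "set (concat (map concat W')) \<subseteq> set (concat (map concat W))"
      using filter[OF d] unfolding cc cW' by blast+
    fix e assume "e \<in> set (concat (map concat W'))"
    then obtain b where b: "b \<in> set (concat W)" "b \<notin> set bs" "e \<in> set b"
      unfolding cc cW' by auto
    then have "e \<in> set (concat (map concat W))"
      unfolding cc by auto
    then have "opposite_end e \<in> set (concat (map concat W))"
      using gauss unfolding gauss_diagram_iff by blast
    then obtain b' where b': "b' \<in> set (concat W)" "opposite_end e \<in> set b'"
      unfolding cc by auto
    have "b' \<notin> set bs"
    proof
      assume "b' \<in> set bs"
      then obtain b'' where b'': "b'' \<in> set bs" "e \<in> set b''"
        using closed[of "opposite_end e"] b' by auto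
      then show False
        using b d bs(2) unfolding distinct_concat_iff by (metis IntI empty_iff subsetD)
    qed
    then show "opposite_end e \<in> set (concat (map concat W'))"
      using b' unfolding cc cW' by auto
  qed
  define idx where "idx = inv_into {..<length bs} ((!) bs)"
  have idx: "idx b = i \<longleftrightarrow> i < length bs \<and> bs ! i = b" if "b \<in> set bs" for b i
  proof -
    have "inj_on ((!) bs) {..<length bs}"
      using bs(1) by (simp add: inj_on_nth)
    moreover have "b \<in> (!) bs ` {..<length bs}"
      using that by (auto simp: in_set_conv_nth)
    ultimately show ?thesis
      unfolding idx_def by (metis f_inv_into_f inv_into_f_f inv_into_into lessThan_iff)
  qed
  define hole :: "endpoint list \<Rightarrow> (endpoint + nat) list" where
    "hole b = (if b \<in> set bs then [Inr (idx b)] else map Inl b)" for b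
  define T where "T = map (\<lambda>w. concat (map hole w)) W"
  have concat_single: "concat (map (\<lambda>e. [e]) b) = b" for b :: "endpoint list"
    by (induction b) auto
  have hole_bs: "concat (map (case_sum (\<lambda>e. [e]) ((!) bs)) (hole b)) = b" for b
    using idx by (auto simp: hole_def comp_def concat_single)
  have hole_Nil: "concat (map (case_sum (\<lambda>e. [e]) ((!) (map (\<lambda>_. []) bs))) (hole b)) =
      (if b \<in> set bs then [] else b)" for b
    using idx[of b "idx b"] by (auto simp: hole_def comp_def concat_single)
  have "concat (map (case_sum (\<lambda>e. [e]) ((!) bs)) (concat (map hole w))) = concat w" for w
    by (induction w) (simp_all add: hole_bs)
  then have fill_bs: "fill bs T = map concat W"
    by (simp add: fill_def T_def)
  have "concat (map (case_sum (\<lambda>e. [e]) ((!) (map (\<lambda>_. []) bs))) (concat (map hole w))) =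
      concat (filter (\<lambda>b. b \<notin> set bs) w)" for w
    by (induction w) (simp_all add: hole_Nil)
  then have fill_Nil: "fill (map (\<lambda>_. []) bs) T = map concat W'"
    by (simp add: fill_def T_def W'_def)
  have cnt: "count_list (concat (map hole L)) (Inr i) = of_bool (i < length bs \<and> bs ! i \<in> set L)"
    if "distinct L" for L i
    using that
  proof (induction L)
    case (Cons b L)
    have "count_list (map Inl b) (Inr i) = 0" for b :: "endpoint list"
      by (induction b) auto
    then have "count_list (hole b) (Inr i) = of_bool (i < length bs \<and> bs ! i = b)"
      using idx[of b i] by (auto simp: hole_def)
    then show ?case
      using Cons by auto
  qed simp
  have "concat T = concat (map hole (concat W))"
    unfolding T_def by (induction W) auto
  then have "has_holes (length bs) T"
    using cnt[OF W] bs(2) nth_mem by (fastforce simp: has_holes_def)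
  then have "diagram_move (fill (map (\<lambda>_. []) bs) T) (Id_on {..<length T}) (fill bs T)"
    using move gauss g' by (intro diagram_move.local) (simp_all add: fill_bs fill_Nil)
  then show ?thesis
    using g' descent_Reidemeister unfolding fill_bs fill_Nil by blast
qed

text \<open>
  Either relative order of the ends in the two blocks is admissible: it decides whether the second
  Reidemeister move is the parallel or the antiparallel one. The first arc of these moves has to be the
  overcrossing one, whence the disjunction.
\<close>

lemma local_move_matched_pairs:
  assumes "csign y = - csign x" "is_Over y = is_Over x"
    "b = [opposite_end y, opposite_end x] \<or> b = [opposite_end x, opposite_end y]"
  shows "local_move [[], []] [[y, x], b] \<or> local_move [[], []] [b, [y, x]]"
proof (cases x)
  case (Over a s)
  then obtain a' where "y = Over a' (- s)"
    using assms by (cases y) auto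
  then show ?thesis
    using Over assms(3) R2_parallel[of a' "- s" a] R2_antiparallel[of a' "- s" a] by auto
next
  case (Under a s)
  then obtain a' where "y = Under a' (- s)"
    using assms by (cases y) auto
  then show ?thesis
    using Under assms(3) R2_parallel[of a' "- s" a] R2_antiparallel[of a s a'] by auto
qed

text \<open>
  A block consisting of the two ends of a chord is removed by a first Reidemeister move. Any other
  block belongs to two chords of opposite sign, whose other ends form a block too, and both blocks
  are removed together by a second Reidemeister move.
\<close>

lemma descent_cancel:
  assumes \<mu>: "rematching X opposite_end (\<lambda>e. csign e = 1) is_Over \<mu>"
    and "gauss_diagram (map concat W)" "set (concat (concat W)) \<subseteq> X"
    and "\<And>b. b \<in> set (concat W) \<Longrightarrow> \<exists>x. b = [\<mu> x, x]"
  shows "descent 0 0 (map concat W) (replicate (length W) [])"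
  using assms(2-)
proof (induction "length (concat W)" arbitrary: W rule: less_induct)
  case less
  have cc: "concat (map concat V) = concat (concat V)" for V :: "endpoint list list list"
    by (induction V) auto
  note gauss = less.prems(1)[unfolded gauss_diagram_iff cc]
  show ?case
  proof (cases "concat W = []")
    case True
    then have "map concat W = replicate (length W) []"
      by (induction W) auto
    then show ?thesis
      using descent.refl[OF less.prems(1)] by simp
  next
    case False
    then obtain b where "b \<in> set (concat W)"
      by (metis list.set_intros(1) neq_Nil_conv)
    then obtain x where b: "[\<mu> x, x] \<in> set (concat W)"
      using less.prems(3) by blast
    define y where "y = \<mu> x"
    have elem: "e \<in> set (concat (concat W))" if "e \<in> set d" "d \<in> set (concat W)" for e d
      using that by auto
    have xX: "x \<in> set (concat (concat W))" "y \<in> set (concat (concat W))"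
      using elem[OF _ b] by (simp_all add: y_def)
    then have X: "x \<in> X" "y \<in> X" "opposite_end x \<in> set (concat (concat W))"
      using less.prems(2) gauss by blast+
    have "[] \<notin> set (concat W)"
      using less.prems(3) by fastforce
    then have dW: "distinct (concat W)"
      using gauss by (simp add: distinct_concat_iff removeAll_id)
    have sign: "csign x \<in> {1, -1}" "csign y \<in> {1, -1}"
      using gauss xX by blast+
    have "\<exists>bs. bs \<noteq> [] \<and> distinct bs \<and> set bs \<subseteq> set (concat W) \<and>
        local_move (map (\<lambda>_. []) bs) bs \<and>
        (\<forall>e\<in>set (concat bs). opposite_end e \<in> set (concat bs))"
    proof (cases "y = opposite_end x")
      case True
      then have "local_move [[]] [[y, x]]"
        using R1_over R1_under by (cases x) auto
      then show ?thesis
        using b True by (intro exI[of _ "[[y, x]]"]) (auto simp: y_def)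
    next
      case False
      then have y: "csign y = - csign x" "is_Over y = is_Over x"
          "\<mu> (opposite_end x) = opposite_end y"
        using \<mu> X(1) sign unfolding rematching_def y_def by auto
      obtain d where d: "d \<in> set (concat W)" "opposite_end x \<in> set d"
        using X(3) by auto
      then obtain u where u: "d = [\<mu> u, u]"
        using less.prems(3) by blast
      have "u \<in> X"
        using elem[OF _ d(1)] less.prems(2) u by auto
      then have dd: "d = [opposite_end y, opposite_end x] \<or> d = [opposite_end x, opposite_end y]"
        using d u y(3) \<mu> unfolding rematching_def by (metis empty_iff empty_set set_ConsD)
      then have ne: "d \<noteq> [y, x]"
        using y(2) by (metis list.inject opposite_end_simps(4))
      obtain bs where bs: "bs = [[y, x], d] \<or> bs = [d, [y, x]]" "local_move [[], []] bs"
        using local_move_matched_pairs[OF y(1,2) dd] by blast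
      have "local_move (map (\<lambda>_. []) bs) bs" "bs \<noteq> []" "distinct bs" "set bs = {[y, x], d}"
        using bs ne by auto
      moreover have "set (concat bs) = {y, x, opposite_end y, opposite_end x}"
        using bs(1) dd by auto
      ultimately show ?thesis
        using b d(1) by (intro exI[of _ bs]) (simp add: y_def)
    qed
    then obtain bs where bs: "bs \<noteq> []" "distinct bs" "set bs \<subseteq> set (concat W)"
        "local_move (map (\<lambda>_. []) bs) bs"
        "\<And>e. e \<in> set (concat bs) \<Longrightarrow> opposite_end e \<in> set (concat bs)"
      by blast
    define V where "V = map (filter (\<lambda>b. b \<notin> set bs)) W"
    have V: "gauss_diagram (map concat V)" "descent 0 0 (map concat W) (map concat V)"
      using descent_remove_blocks[OF less.prems(1) dW bs(2-)] unfolding V_def by blast+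
    have cV: "concat V = filter (\<lambda>b. b \<notin> set bs) (concat W)"
      by (simp add: V_def filter_concat)
    have "length (concat V) < length (concat W)"
      unfolding cV using bs(1,3) by (intro length_filter_less[of "hd bs"]) (auto simp del: set_concat)
    moreover have "set (concat (concat V)) \<subseteq> X"
      using less.prems(2) unfolding cV by auto
    moreover have "\<exists>x. b = [\<mu> x, x]" if "b \<in> set (concat V)" for b
      using less.prems(3) that unfolding cV by auto
    ultimately have "descent 0 0 (map concat V) (replicate (length V) [])"
      using less.hyps V(1) by blast
    from descent_trans[OF this V(2)] show ?thesis
      by (simp add: V_def)
  qed
qed

section \<open>The genus bounds\<close>

text \<open>
  There are \<open>n\<close> saddles and \<open>k - 1\<close> deaths, where \<open>k\<close> is the number of circles that remain when all chords
  have been cancelled. Every such circle has a single colour, so \<open>k \<ge> 2\<close> if \<open>c\<close> takes two values.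
  The hypothesis on \<open>c\<close> says that the arc from each endpoint to its successor is coloured consistently.
\<close>

lemma slice_genus_rematching:
  assumes D: "[w] \<in> K" "gauss_diagram [w]"
    and \<mu>: "rematching (set w) opposite_end (\<lambda>e. csign e = 1) is_Over \<mu>"
    and c: "\<And>i. i < length w \<Longrightarrow> c (w ! (Suc i mod length w)) = c (\<mu> (w ! i))"
  shows "2 * slice_genus K \<le> card (chords [w])"
    and "x \<in> set w \<Longrightarrow> y \<in> set w \<Longrightarrow> c x \<noteq> c y \<Longrightarrow> 2 * slice_genus K < card (chords [w])"
proof -
  let ?n = "card (chords [w])"
  define W where "W = [(c (hd w), map (\<lambda>x. [x]) w)]"
  have flat: "concat (map (\<lambda>x. [x]) w) = w"
    by (induction w) auto
  have W: "blocks W = map (\<lambda>x. [x]) w" "circles W = [w]"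
    by (simp_all add: W_def blocks_def circles_def flat)
  have mu: "\<mu> x \<in> set w" "\<mu> (\<mu> x) = x" "\<mu> x \<noteq> x" if "x \<in> set w" for x
    using \<mu> that unfolding rematching_def by (metis opposite_end_simps(4))+
  have proper: "proper c \<mu> W"
  proof (cases "w = []")
    case False
    have "c (w ! Suc i) = c (\<mu> (w ! i))" if "Suc i < length w" for i
      using c[of i] that by simp
    moreover have "c (hd w) = c (\<mu> (last w))"
      using c[of "length w - 1"] False by (simp add: hd_conv_nth last_conv_nth)
    ultimately show ?thesis
      using coloured_singletons[OF False, of c \<mu>] by (simp add: proper_def W_def)
  qed (simp add: proper_def W_def)
  have "{x. [x] \<in> set (blocks W)} = set w"
    by (auto simp: W)
  then have "card {x. [x] \<in> set (blocks W)} = 2 * ?n"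
    using card_chords[OF D(2)] by simp
  moreover have "distinct (concat (blocks W))"
    using D(2) by (simp add: gauss_diagram_def W flat)
  moreover have "[\<mu> x] \<in> set (blocks W) \<and> \<mu> (\<mu> x) = x \<and> \<mu> x \<noteq> x" if "[x] \<in> set (blocks W)" for x
    using that mu[of x] by (auto simp: W)
  moreover have "length b = 1 \<or> (\<exists>x. b = [\<mu> x, x])" if "b \<in> set (blocks W)" for b
    using that by (auto simp: W)
  ultimately obtain V where V: "surgery ?n [w] (circles V)" "colours c \<mu> W \<subseteq> colours c \<mu> V"
      "\<And>b. b \<in> set (blocks V) \<Longrightarrow> \<exists>x. b = [\<mu> x, x]"
    using surgery_matching[OF _ proper, of ?n] unfolding W(2) by blast
  have colours: "colours c \<mu> V = fst ` set V"
  proof -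
    have "gap_colours c \<mu> g v = {g}" if "(g, v) \<in> set V" for g v
    proof (rule gap_colours_blocks)
      fix b assume "b \<in> set v"
      then have "b \<in> set (blocks V)"
        using that by (force simp: blocks_def)
      then show "length b \<noteq> 1"
        using V(3) by force
    qed
    then show ?thesis
      unfolding colours_def by force
  qed
  have hd: "c (hd w) \<in> colours c \<mu> W"
    using gap_colours_start by (force simp: colours_def W_def)
  define k where "k = length V"
  have k1: "1 \<le> k"
    using hd V(2) colours by (cases V) (auto simp: k_def)
  have k2: "2 \<le> k" if "x \<in> set w" "y \<in> set w" "c x \<noteq> c y" for x y
  proof -
    have "c ` set w \<subseteq> colours c \<mu> W"
      using proper gap_colours_singletons[of c \<mu>] by (force simp: proper_def W_def colours_def)
    then have "{c x, c y} \<subseteq> fst ` set V"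
      using V(2) colours that by blast
    then have "card {c x, c y} \<le> card (fst ` set V)"
      by (intro card_mono) auto
    also have "\<dots> \<le> k"
      unfolding k_def using card_image_le card_length by (metis List.finite_set le_trans)
    finally show ?thesis
      using that(3) by simp
  qed
  have s: "descent ?n 0 [w] (circles V)"
    using surgery_descent[OF V(1) D(2)] .
  have cV: "circles V = map concat (map snd V)"
    by (simp add: circles_def)
  have "set (concat (concat (map snd V))) = set w"
    using arg_cong[OF surgery_mset[OF V(1)], of set_mset] unfolding concat_circles
    by (simp add: blocks_def)
  then have "descent 0 0 (circles V) (replicate k [])"
    using descent_cancel[OF \<mu>, of "map snd V"] V(3) descent_gauss[OF s]
    unfolding cV by (simp add: k_def blocks_def)
  from descent_trans[OF this s] have "descent ?n 0 [w] (replicate (Suc (k - 1)) [])"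
    using k1 by simp
  from descent_trans[OF descent_deaths this] have d: "descent ?n (k - 1) [w] [[]]"
    by simp
  \<comment> \<open>\<open>m\<close> counts the mergers among the saddles, and is the genus \<open>(n - (k - 1)) / 2\<close>.\<close>
  obtain m where "1 + ?n = k + 2 * m"
    using surgery_length[OF V(1)] by (auto simp: k_def circles_def)
  then have "slice_genus K \<le> m" "1 + ?n = k + 2 * m"
    using slice_genus_le[OF d D(1)] k1 by auto
  then have "2 * slice_genus K + k \<le> ?n + 1"
    by simp
  then show "2 * slice_genus K \<le> ?n"
    and "x \<in> set w \<Longrightarrow> y \<in> set w \<Longrightarrow> c x \<noteq> c y \<Longrightarrow> 2 * slice_genus K < ?n"
    using k1 k2[of x y] by auto
qed

lemma gauss_diagram_chord_circle:
  assumes gauss: "gauss_diagram [w]"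
  obtains \<sigma> where "chord_circle (set w) \<sigma> opposite_end (\<lambda>e. csign e = 1) is_Over"
    "\<And>i. i < length w \<Longrightarrow> \<sigma> (w ! i) = w ! (Suc i mod length w)"
proof -
  have dist: "distinct w"
    using gauss by (simp add: gauss_diagram_def)
  define \<sigma> where "\<sigma> x = w ! (Suc (inv_into {..<length w} ((!) w) x) mod length w)" for x
  have \<sigma>: "\<sigma> (w ! i) = w ! (Suc i mod length w)" if "i < length w" for i
    using inj_on_nth[OF dist, of "{..<length w}"] that by (simp add: \<sigma>_def)
  have less: "Suc i mod length w < length w" if "i < length w" for i
    using that by (intro mod_less_divisor) linarith
  have "chord_circle (set w) \<sigma> opposite_end (\<lambda>e. csign e = 1) is_Over"
  proof
    show "finite (set w)" by simp
    show "\<sigma> x \<in> set w" if "x \<in> set w" for x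
      using that \<sigma> less by (metis in_set_conv_nth nth_mem)
    show "inj_on \<sigma> (set w)"
    proof (rule inj_onI)
      fix x y assume "x \<in> set w" "y \<in> set w" and eq: "\<sigma> x = \<sigma> y"
      then obtain i j where ij: "i < length w" "x = w ! i" "j < length w" "y = w ! j"
        by (metis in_set_conv_nth)
      then have "Suc i mod length w = Suc j mod length w"
        using eq \<sigma> less dist by (simp add: nth_eq_iff_index_eq)
      then have "i = j"
        using ij by (auto simp: mod_Suc split: if_splits)
      then show "x = y"
        using ij by simp
    qed
    show "set w \<subseteq> J" if J: "\<And>x. x \<in> set w \<Longrightarrow> \<sigma> x \<in> J \<longleftrightarrow> x \<in> J" and x: "x \<in> set w" "x \<in> J" for x J
    proof -
      have "w ! i \<in> J \<longleftrightarrow> w ! 0 \<in> J" if "i < length w" for i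
        using that
      proof (induction i)
        case (Suc i)
        then show ?case using J[of "w ! i"] \<sigma>[of i] by simp
      qed simp
      then show ?thesis
        using x by (metis in_set_conv_nth subsetI)
    qed
    show "opposite_end x \<in> set w" if "x \<in> set w" for x
      using gauss_diagram_opposite_end[OF gauss] that by simp
  qed simp_all
  then show thesis
    using that \<sigma> by blast
qed

theorem theorem2:
  fixes K :: "diagram set" and n :: nat
  assumes "K \<in> virtual_knots"
    and "crossing_number K = n"
  shows "real (slice_genus K) \<le> real n / 2 \<and>
    ((\<exists>D \<in> K. card (chords D) = n \<and> (\<exists>a. (a, 1) \<in> chords D) \<and> (\<exists>b. (b, -1) \<in> chords D))
      \<longrightarrow> real (slice_genus K) \<le> (real n - 1) / 2)"
proof -
  obtain D0 where D0: "knot_diagram D0" "K = virtual_equiv `` {D0}"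
    using assms(1) by (auto simp: virtual_knots_def elim!: quotientE)
  have K: "\<exists>w. D = [w] \<and> gauss_diagram [w]" if "D \<in> K" for D
  proof -
    have "length D = 1" "gauss_diagram D"
      using virtual_equiv_gauss[of D0 D] D0 that by (auto simp: knot_diagram_def)
    then show ?thesis
      by (auto simp: length_Suc_conv)
  qed
  have "D0 \<in> K"
    by (simp add: D0 virtual_equiv_def)
  then have "\<exists>D\<in>K. card (chords D) = n"
    using LeastI[of "\<lambda>n. \<exists>D\<in>K. card (chords D) = n"] assms(2)
    unfolding crossing_number_def by blast
  then obtain w where w: "[w] \<in> K" "gauss_diagram [w]" "card (chords [w]) = n"
    using K by blast
  have "rematching (set w) opposite_end (\<lambda>e. csign e = 1) is_Over opposite_end"
    using gauss_diagram_opposite_end[OF w(2)] by (simp add: rematching_def)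
  \<comment> \<open>A constant colouring is consistent for every matching.\<close>
  from slice_genus_rematching(1)[OF w(1,2) this, of "\<lambda>_. True"]
  have "2 * slice_genus K \<le> n"
    using w(3) by simp
  moreover have "2 * slice_genus K + 1 \<le> n"
    if "D \<in> K" "card (chords D) = n" "(a, 1) \<in> chords D" "(b, -1) \<in> chords D" for D a b
  proof -
    obtain v where v: "D = [v]" "gauss_diagram [v]"
      using K[OF \<open>D \<in> K\<close>] by blast
    obtain \<sigma> where \<sigma>: "chord_circle (set v) \<sigma> opposite_end (\<lambda>e. csign e = 1) is_Over"
      "\<And>i. i < length v \<Longrightarrow> \<sigma> (v ! i) = v ! (Suc i mod length v)"
      using gauss_diagram_chord_circle[OF v(2)] by blast
    interpret chord_circle "set v" \<sigma> opposite_end "\<lambda>e. csign e = 1" is_Over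
      by (rule \<sigma>(1))
    have "Over a 1 \<in> set v" "Over b (-1) \<in> set v"
      using that v by (auto simp: chords_def)
    then obtain \<mu> J where \<mu>: "rematching (set v) opposite_end (\<lambda>e. csign e = 1) is_Over \<mu>"
        and J: "splits \<mu> J"
      using splitting_rematching[of "Over a 1" "Over b (-1)"] by auto
    have J_step: "(v ! (Suc i mod length v) \<in> J) = (\<mu> (v ! i) \<in> J)" if "i < length v" for i
    proof -
      have "v ! i \<in> set v" using that by simp
      then have "\<mu> (v ! i) \<in> set v" "\<mu> (\<mu> (v ! i)) = v ! i"
        using \<mu> unfolding rematching_def by blast+
      then show ?thesis
        using J \<sigma>(2)[OF that] unfolding splits_def by metis
    qed
    obtain x y where "x \<in> set v" "y \<in> set v" "(x \<in> J) \<noteq> (y \<in> J)"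
      using J unfolding splits_def by blast
    from slice_genus_rematching(2)[of v K \<mu> "\<lambda>x. x \<in> J", OF _ v(2) \<mu> J_step this]
    show ?thesis
      using that(1,2) v(1) by simp
  qed
  ultimately show ?thesis
    by (fastforce simp: field_simps)
qed

end
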